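(* Let $q=2^h$ and let $\mathcal{A}$ be a KM-arc of type $q/4$ in $\mathrm{PG}(2,q)$. If $\ell$ is a $q/4$-secant of $\mathcal{A}$ such that $\mathcal{A}$ has property (II) with respect to $\ell$, then there exist $\alpha,\beta\in\mathbb{F}_q\setminus\{0,1\}$ with $\alpha\beta\neq 1$ and $\alpha\beta^2\neq 1$, and $a,b\in\mathbb{F}_2$, such that $\mathcal{A}$ is $\mathrm{PGL}(3,q)$-equivalent to $\mathcal{A}_{\alpha,\beta,a,b}$.
   Context: Let $\mathrm{Tr}$ be the absolute trace $\mathbb{F}_q\to\mathbb{F}_2$. For $\alpha,\beta\in\mathbb{F}_q\setminus\{0,1\}$, $\alpha\beta\ne1$, put $\gamma=\frac{\beta+1}{\alpha\beta+1}$, $\xi=\alpha\beta\gamma$; for $a,b\in\mathbb{F}_2$, $\mathcal{A}_{\alpha,\beta,a,b}$ is the union of $\{(z,1,0): \mathrm{Tr}(z)=0,\mathrm{Tr}(z/\alpha)=a\}$, $\{(z,0,1):\mathrm{Tr}(z)=0,\mathrm{Tr}(z/(\alpha\gamma))=0\}$, $\{(z,1,1):\mathrm{Tr}(z)=1,\mathrm{Tr}(z/(\alpha\beta))=b\}$, $\{(z,\gamma,1):\mathrm{Tr}(z/(\alpha\gamma))=a+1,\mathrm{Tr}(z/\xi)=b+1\}$, $\{(z,\beta+1,1):\mathrm{Tr}(z/(\alpha\beta))=a+b+1,\mathrm{Tr}(z/\xi)=b\}$ ($z\in\mathbb{F}_q$). A KM-arc of type $t$ is a set of $q+t$ points such that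 every line meets it in $0$, $2$ or $t$ points, each value occurring; a KM-arc of type $q/4$ has five $q/4$-secants, concurrent in its nucleus $N$. An $\mathbb{F}_2$-linear set of rank $k$ on a line (viewed as $\mathrm{PG}(1,q)$) is the set of points defined by the nonzero vectors of a $k$-dimensional $\mathbb{F}_2$-subspace $W$ of $\mathbb{F}_q^2$; weight of $\langle v\rangle$ is $\dim_{\mathbb{F}_2}(W\cap\langle v\rangle_{\mathbb{F}_q})$; an $i$-club of rank $k$ has one point (head) of weight $i$, all others of weight $1$. With $\ell_0=\ell$ and the other secants $\ell_1,\dots,\ell_4$, $S_i=\ell_i\cap\mathcal{A}$, $D_{ij}=\{\langle P,Q\rangle\cap\ell_0: P\in S_i,Q\in S_j\}$: property (II) w.r.t. $\ell_0$ means (1) each $S_i\cup\{N\}$ ($i=1..4$) is an $\mathbb{F}_2$-linear $(h-2)$-club of rank $h-1$; (2) $D_{12}=D_{34}$, $D_{13}=D_{24}$, $D_{14}=D_{23}$; (3) $D_{12}\cup\{N\},D_{13}\cup\{N\},D_{14}\cup\{N\}$ are $\mathbb{F}_2$-linear $(h-1)$-clubs of rank $h$ with head $N$; (4) $|D_{12}\cap D_{13}|=|D_{12}\cap D_{14}|=|D_{13}\cap D_{14}|=q/4$; (5) $D_{12}\cap D_{13}\cap D_{14}=\emptyset$. *)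

theory Defs
  imports "HOL-Analysis.Analysis" "HOL-Library.Z2" "HOL-Number_Theory.Residues"
begin

section \<open>The field of two elements inside a field of order \<open>2 ^ h\<close>\<close>

text \<open>
  The ground field is a type \<open>'a :: {field, finite}\<close> with \<open>CARD('a) = 2 ^ h\<close>. The field of
  two elements is the type \<^typ>\<open>bit\<close>, included in \<open>'a\<close> as its prime field.
\<close>

definition of_F2 :: "bit \<Rightarrow> 'a::zero_neq_one" where
  "of_F2 c = (if c = 1 then 1 else 0)"

text \<open>Restriction of scalars: the scalar multiplication of \<open>'a ^ 'n\<close> over the field \<^typ>\<open>bit\<close>.\<close>

definition F2_scale :: "bit \<Rightarrow> 'a::field ^ 'n \<Rightarrow> 'a ^ 'n" where
  "F2_scale c v = of_F2 c *s v"

abbreviation F2_subspace :: "('a::field ^ 'n) set \<Rightarrow> bool" where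
  "F2_subspace \<equiv> module.subspace F2_scale"

abbreviation F2_dim :: "('a::field ^ 'n) set \<Rightarrow> nat" where
  "F2_dim \<equiv> vector_space.dim F2_scale"

lemma vector_space_F2_scale:
  assumes "CARD('a::{field,finite}) = 2 ^ h"
  shows "vector_space (F2_scale :: bit \<Rightarrow> 'a ^ 'n \<Rightarrow> 'a ^ 'n)"
proof -
  have "prime CHAR('a)"
    by (rule prime_CHAR_semidom) (simp add: finite_imp_CHAR_pos)
  moreover have "CHAR('a) dvd 2 ^ h"
    using CHAR_dvd_CARD[where 'a = 'a] assms by simp
  ultimately have "CHAR('a) dvd 2"
    by (meson prime_dvd_power)
  then have "of_nat 2 = (0::'a)"
    by (simp only: of_nat_eq_0_iff_char_dvd)
  then have two: "(1::'a) + 1 = 0"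
    by simp
  have "of_F2 (a + b) = (of_F2 a + of_F2 b :: 'a)"
    and "of_F2 (a * b) = (of_F2 a * of_F2 b :: 'a)" for a b
    using two by (cases a; cases b; simp add: of_F2_def)+
  then show ?thesis
    by unfold_locales
      (simp_all add: F2_scale_def vec.scale_right_distrib vec.scale_left_distrib of_F2_def)
qed

text \<open>The absolute trace, as an element of the prime field of \<open>'a\<close>.\<close>

definition abs_trace :: "nat \<Rightarrow> 'a::field \<Rightarrow> 'a" where
  "abs_trace h x = (\<Sum>i<h. x ^ (2 ^ i))"


section \<open>The projective plane and KM-arcs\<close>

text \<open>
  Points and lines are the subspaces of \<open>'a ^ 3\<close> of dimension 1 and 2; incidence is inclusion.
\<close>

definition points :: "('a::field ^ 3) set set" where
  "points = {P. vec.subspace P \<and> vec.dim P = 1}"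

definition lines :: "('a::field ^ 3) set set" where
  "lines = {l. vec.subspace l \<and> vec.dim l = 2}"

definition pt :: "'a::field \<Rightarrow> 'a \<Rightarrow> 'a \<Rightarrow> ('a ^ 3) set" where
  "pt x y z = vec.span {vector [x, y, z]}"

definition points_on :: "('a::field ^ 3) set set \<Rightarrow> ('a ^ 3) set \<Rightarrow> ('a ^ 3) set set" where
  "points_on A l = {P \<in> A. P \<subseteq> l}"

definition join :: "('a::field ^ 3) set \<Rightarrow> ('a ^ 3) set \<Rightarrow> ('a ^ 3) set" where
  "join P Q = vec.span (P \<union> Q)"

definition KM_arc :: "nat \<Rightarrow> ('a::{field,finite} ^ 3) set set \<Rightarrow> bool" where
  "KM_arc t A \<longleftrightarrow> A \<subseteq> points \<and> card A = CARD('a) + t \<and>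
     (\<lambda>l. card (points_on A l)) ` lines = {0, 2, t}"

definition secants :: "nat \<Rightarrow> ('a::{field,finite} ^ 3) set set \<Rightarrow> ('a ^ 3) set set" where
  "secants t A = {l \<in> lines. card (points_on A l) = t}"

definition PGL_equivalent ::
    "('a::{field,finite} ^ 3) set set \<Rightarrow> ('a ^ 3) set set \<Rightarrow> bool" where
  "PGL_equivalent A B \<longleftrightarrow>
     (\<exists>M :: 'a ^ 3 ^ 3. invertible M \<and> (\<lambda>P. (\<lambda>v. M *v v) ` P) ` A = B)"


section \<open>Linear sets and clubs on a line\<close>

definition linear_set :: "('a::field ^ 3) set \<Rightarrow> ('a ^ 3) set set" where
  "linear_set W = {vec.span {v} |v. v \<in> W \<and> v \<noteq> 0}"

definition weight :: "('a::field ^ 3) set \<Rightarrow> ('a ^ 3) set \<Rightarrow> nat" where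
  "weight W P = F2_dim (W \<inter> P)"

text \<open>
  \<open>club_with_head l i k H S\<close>: the set \<open>S\<close> of points of the line \<open>l\<close> is an \<open>i\<close>-club of
  rank \<open>k\<close> with head \<open>H\<close>. The two-dimensional space \<open>l\<close> plays the role of the space
  underlying \<open>PG(1,q)\<close>.
\<close>

definition club_with_head ::
    "('a::{field,finite} ^ 3) set \<Rightarrow> nat \<Rightarrow> nat \<Rightarrow> ('a ^ 3) set \<Rightarrow> ('a ^ 3) set set \<Rightarrow> bool" where
  "club_with_head l i k H S \<longleftrightarrow>
     (\<exists>W. F2_subspace W \<and> W \<subseteq> l \<and> F2_dim W = k \<and> S = linear_set W \<and>
       H \<in> S \<and> weight W H = i \<and> (\<forall>P \<in> S - {H}. weight W P = 1))"

definition club ::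
    "('a::{field,finite} ^ 3) set \<Rightarrow> nat \<Rightarrow> nat \<Rightarrow> ('a ^ 3) set set \<Rightarrow> bool" where
  "club l i k S \<longleftrightarrow> (\<exists>H. club_with_head l i k H S)"


section \<open>Property (II)\<close>

text \<open>
  \<open>D_set A l m n\<close> consists of the points in which \<open>l\<close> meets the lines joining a point of
  \<open>A\<close> on \<open>m\<close> to a point of \<open>A\<close> on \<open>n\<close>.
\<close>

definition D_set ::
    "('a::field ^ 3) set set \<Rightarrow> ('a ^ 3) set \<Rightarrow> ('a ^ 3) set \<Rightarrow> ('a ^ 3) set \<Rightarrow> ('a ^ 3) set set"
  where
  "D_set A l m n = {join P Q \<inter> l |P Q. P \<in> points_on A m \<and> Q \<in> points_on A n}"

text \<open>
  The conditions are invariant under permutations of the four secants other than \<open>l0\<close>, so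
  it is immaterial how these are numbered.
\<close>

definition property_II ::
    "nat \<Rightarrow> ('a::{field,finite} ^ 3) set set \<Rightarrow> ('a ^ 3) set \<Rightarrow> bool" where
  "property_II h A l0 \<longleftrightarrow>
     (\<exists>N l1 l2 l3 l4.
        distinct [l0, l1, l2, l3, l4] \<and>
        secants (CARD('a) div 4) A = {l0, l1, l2, l3, l4} \<and>
        N \<in> points \<and> (\<forall>l \<in> {l0, l1, l2, l3, l4}. N \<subseteq> l) \<and>
        (let D12 = D_set A l0 l1 l2; D34 = D_set A l0 l3 l4;
             D13 = D_set A l0 l1 l3; D24 = D_set A l0 l2 l4;
             D14 = D_set A l0 l1 l4; D23 = D_set A l0 l2 l3
         in
           (\<forall>l \<in> {l1, l2, l3, l4}. club l (h - 2) (h - 1) (points_on A l \<union> {N})) \<and>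
           D12 = D34 \<and> D13 = D24 \<and> D14 = D23 \<and>
           (\<forall>D \<in> {D12, D13, D14}. club_with_head l0 (h - 1) h N (D \<union> {N})) \<and>
           card (D12 \<inter> D13) = CARD('a) div 4 \<and>
           card (D12 \<inter> D14) = CARD('a) div 4 \<and>
           card (D13 \<inter> D14) = CARD('a) div 4 \<and>
           D12 \<inter> D13 \<inter> D14 = {}))"


section \<open>The family of KM-arcs\<close>

definition arc_family ::
    "nat \<Rightarrow> 'a::{field,finite} \<Rightarrow> 'a \<Rightarrow> bit \<Rightarrow> bit \<Rightarrow> ('a ^ 3) set set" where
  "arc_family h \<alpha> \<beta> a b =
     (let Tr = abs_trace h;
          \<gamma> = (\<beta> + 1) / (\<alpha> * \<beta> + 1);
          \<xi> = \<alpha> * \<beta> * \<gamma>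
      in
        {pt z 1 0 |z. Tr z = 0 \<and> Tr (z / \<alpha>) = of_F2 a} \<union>
        {pt z 0 1 |z. Tr z = 0 \<and> Tr (z / (\<alpha> * \<gamma>)) = 0} \<union>
        {pt z 1 1 |z. Tr z = 1 \<and> Tr (z / (\<alpha> * \<beta>)) = of_F2 b} \<union>
        {pt z \<gamma> 1 |z. Tr (z / (\<alpha> * \<gamma>)) = of_F2 (a + 1) \<and> Tr (z / \<xi>) = of_F2 (b + 1)} \<union>
        {pt z (\<beta> + 1) 1 |z. Tr (z / (\<alpha> * \<beta>)) = of_F2 (a + b + 1) \<and> Tr (z / \<xi>) = of_F2 b})"

end

theory Submission
  imports Defs
begin

text \<open>
  Put the nucleus at \<open>(1,0,0)\<close>, the distinguished secant at \<open>(z,1,0)\<close> and the others at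
  \<open>(z,s\<^sub>i,1)\<close>, with point sets \<open>S\<^sub>i \<subseteq> F\<^sub>q\<close>. Then \<open>D\<^sub>i\<^sub>j = (S\<^sub>i + S\<^sub>j) / (s\<^sub>i + s\<^sub>j)\<close>, and
  the club condition makes the three sets \<open>D\<^sub>i\<^sub>j\<close> affine hyperplanes \<open>Tr (a\<^sub>k z) = e\<^sub>k\<close>. Since they
  meet pairwise in \<open>q/4\<close> points but have no common point, \<open>a\<^sub>3 = a\<^sub>1 + a\<^sub>2\<close> and
  \<open>e\<^sub>3 = e\<^sub>1 + e\<^sub>2 + 1\<close>; their complement is the point set of the distinguished secant.
  On \<open>S\<^sub>i\<close> each of the three functionals \<open>f\<^sub>i\<^sub>j = a\<^sub>k / (s\<^sub>i + s\<^sub>j)\<close> has constant trace, and as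
  \<open>S\<^sub>i\<close> has \<open>q/4\<close> elements they span at most two dimensions. Two of them cannot coincide: then
  all three functionals on the edges of a triangle would coincide, forcing
  \<open>e\<^sub>3 = e\<^sub>1 + e\<^sub>2\<close>. So their sum is \<open>0\<close> and any two of them determine \<open>S\<^sub>i\<close>. After normalising
  \<open>s\<^sub>1 = 0\<close>, \<open>s\<^sub>2 = 1\<close>, \<open>a\<^sub>1 = 1\<close> and writing \<open>a\<^sub>2 = 1 / \<alpha>\<close>, \<open>s\<^sub>4 = \<beta> + 1\<close>, the relation at the
  first secant says that \<open>s\<^sub>3\<close> is the \<open>\<gamma>\<close> of the family. Finally \<open>\<alpha> \<beta>\<^sup>2 = 1\<close> would give \<open>S\<^sub>1\<close> and
  \<open>S\<^sub>2\<close> the same direction space, making \<open>D\<^sub>1\<^sub>2\<close> too small.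
\<close>

section \<open>The trace form of a binary field\<close>

locale binary_field =
  fixes h :: nat and ty :: "'a::{field,finite} itself"
  assumes card_field: "CARD('a) = 2 ^ h"
begin

abbreviation Tr :: "'a \<Rightarrow> 'a" where
  "Tr \<equiv> abs_trace h"

text \<open>Scalars in \<open>bit\<close> satisfy 1 + 1 = 0, and distributivity of
  \<open>F2_scale\<close> transports this to the field.\<close>

lemma two_eq_0: "(2::'a) = 0"
proof -
  have "vector_space (F2_scale :: bit \<Rightarrow> 'a ^ 1 \<Rightarrow> 'a ^ 1)"
    by (rule vector_space_F2_scale[OF card_field])
  then interpret vector_space "F2_scale :: bit \<Rightarrow> 'a ^ 1 \<Rightarrow> 'a ^ 1" .
  have "F2_scale (1 + 1) (1::'a ^ 1) = F2_scale 1 1 + F2_scale 1 1"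
    by (rule scale_left_distrib)
  then have "F2_scale 1 (1::'a ^ 1) + F2_scale 1 1 = 0"
    by simp
  then have "(1::'a) + 1 = 0"
    by (simp add: F2_scale_def of_F2_def vec_eq_iff)
  then show ?thesis by simp
qed

section \<open>Arithmetic in characteristic 2\<close>

lemma add_self [simp]: "x + x = (0::'a)"
  by (metis mult_2 mult_zero_left two_eq_0)

lemma add_self_left [simp]: "x + (x + y) = (y::'a)"
  by (simp flip: add.assoc)

lemma uminus_eq [simp]: "- x = (x::'a)"
  by (rule minus_unique) simp

lemma diff_eq [simp]: "x - y = (x + y::'a)"
  by (simp only: diff_conv_add_uminus uminus_eq)

lemma add_eq_0_iff_eq [simp]: "x + y = 0 \<longleftrightarrow> x = (y::'a)"
  by (metis add_self add_self_left add.right_neutral)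

lemma add_eq_iff: "x + y = z \<longleftrightarrow> x = (y + z::'a)"
  by (metis add_self_left add.commute)

lemma h_pos: "h > 0"
proof (rule ccontr)
  assume "\<not> h > 0"
  then have "CARD('a) = 1" using card_field by simp
  then have "(0::'a) = 1"
    by (metis UNIV_I card_1_singletonE singletonD)
  then show False by simp
qed

text \<open>Multiplication by a nonzero \<open>x\<close> permutes the nonzero elements, so their
  product is unchanged and the power of \<open>x\<close> with exponent q - 1 is 1.\<close>

lemma power_card: "(x::'a) ^ 2 ^ h = x"
proof (cases "x = 0")
  case False
  let ?U = "UNIV - {0::'a}"
  have "(\<Prod>y\<in>?U. x * y) = \<Prod>?U"
    by (rule prod.reindex_bij_witness[of _ "\<lambda>y. y / x" "\<lambda>y. x * y"]) (use False in auto)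
  then have "x ^ card ?U * \<Prod>?U = \<Prod>?U"
    by (simp add: prod.distrib)
  then have "x ^ card ?U = 1"
    by simp
  then have "x ^ Suc (card ?U) = x"
    by (simp only: power_Suc mult_1_right)
  moreover have "Suc (card ?U) = CARD('a)"
    by (rule card_Suc_Diff1) auto
  ultimately show ?thesis
    by (simp only: card_field)
qed (simp add: zero_power)

lemma add_power_two_power: "(x + y) ^ 2 ^ i = x ^ 2 ^ i + (y::'a) ^ 2 ^ i"
proof (induction i)
  case (Suc i)
  have "(u + v)\<^sup>2 = u\<^sup>2 + v\<^sup>2" for u v :: 'a
    using two_eq_0 by (simp add: power2_sum)
  then show ?case
    using Suc by (simp add: power_mult mult.commute[of 2])
qed simp

section \<open>The absolute trace\<close>

lemma Tr_0 [simp]: "Tr 0 = 0"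
  by (simp add: abs_trace_def zero_power)

lemma Tr_add: "Tr (x + y) = Tr x + Tr y"
  by (simp add: abs_trace_def add_power_two_power sum.distrib)

text \<open>Squaring shifts the summands cyclically because \<open>x ^ 2 ^ h = x\<close>, so the
  trace is a root of T^2 + T.\<close>

lemma Tr_in_F2: "Tr x \<in> {0, 1}"
proof -
  have "(Tr x)\<^sup>2 = (\<Sum>i<h. x ^ 2 ^ Suc i)"
  proof -
    have "(\<Sum>i\<in>I. f i)\<^sup>2 = (\<Sum>i\<in>I. (f i)\<^sup>2)" for f :: "nat \<Rightarrow> 'a" and I
      using add_power_two_power[where i = 1] by (induction I rule: infinite_finite_induct) auto
    then show ?thesis
      by (simp add: abs_trace_def mult.commute flip: power_mult)
  qed
  also have "\<dots> = (\<Sum>i<Suc h. x ^ 2 ^ i) + x"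
    by (simp only: sum.lessThan_Suc_shift) (simp add: ac_simps)
  also have "\<dots> = Tr x"
    by (simp add: abs_trace_def power_card ac_simps)
  finally have "Tr x * (Tr x + 1) = 0"
    by (simp add: power2_eq_square distrib_left)
  then show ?thesis by auto
qed

text \<open>The trace is a polynomial of degree at most 2^(h-1) with linear coefficient 1. Hence it
  is not the zero polynomial and has fewer than q roots.\<close>

lemma ex_Tr_neq_0: "\<exists>x. Tr x \<noteq> 0"
proof (rule ccontr)
  assume *: "\<nexists>x. Tr x \<noteq> 0"
  define p :: "'a poly" where "p = (\<Sum>i<h. Polynomial.monom 1 (2 ^ i))"
  have "poly p x = Tr x" for x
    by (simp add: p_def poly_sum poly_monom abs_trace_def)
  then have roots: "{x. poly p x = 0} = UNIV"
    using * by auto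
  have "Polynomial.coeff p 1 = (\<Sum>i<h. if i = 0 then 1 else 0)"
    unfolding p_def coeff_sum by (rule sum.cong) auto
  then have "p \<noteq> 0"
    using h_pos by auto
  then have "2 ^ h \<le> Polynomial.degree p"
    using card_poly_roots_bound[of p] roots card_field by simp
  moreover have "Polynomial.degree p \<le> 2 ^ (h - 1)"
    unfolding p_def by (rule degree_sum_le) (auto intro: order_trans[OF degree_monom_le])
  moreover have "(2::nat) ^ (h - 1) < 2 ^ h"
    using h_pos by simp
  ultimately show False by simp
qed

lemma ex_Tr_mult_eq_1:
  assumes "a \<noteq> 0"
  shows "\<exists>x. Tr (a * x) = 1"
proof -
  obtain y where "Tr y \<noteq> 0" using ex_Tr_neq_0 by auto
  then have "Tr (a * (y / a)) = 1" using assms Tr_in_F2[of y] by auto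
  then show ?thesis by blast
qed

section \<open>Duality for the trace form\<close>

definition additive_subgroup :: "'a set \<Rightarrow> bool" where
  "additive_subgroup F \<longleftrightarrow> 0 \<in> F \<and> (\<forall>x\<in>F. \<forall>y\<in>F. x + y \<in> F)"

definition perp :: "'a set \<Rightarrow> 'a set" where
  "perp F = {z. \<forall>f\<in>F. Tr (f * z) = 0}"

lemma additive_subgroup_perp: "additive_subgroup (perp F)"
  by (simp add: additive_subgroup_def perp_def distrib_left Tr_add)

text \<open>The additive character of the field attached to the trace, with values in
  \<open>int\<close> so that its sums count elements.\<close>

definition chi :: "'a \<Rightarrow> int" where
  "chi x = (if Tr x = 0 then 1 else - 1)"

lemma chi_add: "chi (x + y) = chi x * chi y"
  using Tr_in_F2[of x] Tr_in_F2[of y] by (auto simp: chi_def Tr_add)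

text \<open>Orthogonality: if \<open>a\<close> is outside \<open>perp F\<close>, translation by some
  \<open>u\<close> in \<open>F\<close> with \<open>chi (a * u) = - 1\<close> negates the
  sum.\<close>

lemma sum_chi:
  assumes "additive_subgroup F"
  shows "(\<Sum>z\<in>F. chi (a * z)) = (if a \<in> perp F then int (card F) else 0)"
proof (cases "a \<in> perp F")
  case True
  then show ?thesis by (simp add: chi_def perp_def mult.commute)
next
  case False
  then obtain u where u: "u \<in> F" "chi (a * u) = - 1"
    by (auto simp: perp_def chi_def mult.commute)
  have "(\<Sum>z\<in>F. chi (a * z)) = (\<Sum>z\<in>F. chi (a * (z + u)))"
    using assms u(1)
    by (intro sum.reindex_bij_witness[of _ "\<lambda>z. z + u" "\<lambda>z. z + u"])
      (auto simp: additive_subgroup_def add.assoc)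
  also have "\<dots> = - (\<Sum>z\<in>F. chi (a * z))"
    using u(2) by (simp add: distrib_left chi_add sum_negf)
  finally show ?thesis using False by simp
qed

text \<open>The double sum of \<open>chi (a * z)\<close> over all \<open>a\<close> and all
  \<open>z\<close> in \<open>F\<close> is evaluated in both orders. Summing over \<open>z\<close>
  first leaves |F| for each \<open>a\<close> in \<open>perp F\<close>; summing over \<open>a\<close>
  first leaves q from z = 0 alone, since \<open>perp UNIV\<close> is trivial.\<close>

lemma card_perp:
  assumes "additive_subgroup F"
  shows "card F * card (perp F) = 2 ^ h"
proof -
  have "perp UNIV = {0::'a}"
    using ex_Tr_mult_eq_1 by (force simp: perp_def mult.commute)
  have UNIV: "additive_subgroup UNIV"
    by (simp add: additive_subgroup_def)
  have "int (card F * card (perp F)) = (\<Sum>a\<in>UNIV. if a \<in> perp F then int (card F) else 0)"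
    by (simp add: sum.If_cases)
  also have "\<dots> = (\<Sum>a\<in>UNIV. \<Sum>z\<in>F. chi (a * z))"
    by (simp add: sum_chi[OF assms])
  also have "\<dots> = (\<Sum>z\<in>F. \<Sum>a\<in>UNIV. chi (z * a))"
    by (subst sum.swap) (simp add: mult.commute)
  also have "\<dots> = (\<Sum>z\<in>F. if z = 0 then 2 ^ h else 0)"
    by (simp add: sum_chi[OF UNIV] \<open>perp UNIV = {0}\<close> card_field)
  also have "\<dots> = 2 ^ h"
    using assms by (simp add: additive_subgroup_def)
  finally show ?thesis
    by (metis of_nat_eq_iff of_nat_numeral of_nat_power)
qed

lemma perp_perp:
  assumes "additive_subgroup F"
  shows "perp (perp F) = F"
proof -
  have "card (perp F) * card (perp (perp F)) = card (perp F) * card F"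
    using card_perp[OF assms] card_perp[OF additive_subgroup_perp]
    by (simp add: mult.commute)
  moreover have "0 \<in> perp F" by (simp add: perp_def)
  then have "card (perp F) \<noteq> 0" by auto
  ultimately have "card F = card (perp (perp F))" by simp
  moreover have "F \<subseteq> perp (perp F)"
    by (auto simp: perp_def mult.commute)
  ultimately show ?thesis
    by (metis card_subset_eq finite)
qed

lemma ex_perp_Tr_eq_1:
  assumes "additive_subgroup F" and "g \<notin> F"
  shows "\<exists>z\<in>perp F. Tr (g * z) = 1"
proof -
  have "g \<notin> perp (perp F)"
    using assms by (simp add: perp_perp)
  then obtain z where "z \<in> perp F" "Tr (z * g) \<noteq> 0"
    by (auto simp: perp_def)
  then show ?thesis
    using Tr_in_F2[of "z * g"] by (auto simp: mult.commute)
qed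

section \<open>Systems of trace equations\<close>

lemma additive_subgroup_1: "additive_subgroup {0, f}"
  by (auto simp: additive_subgroup_def)

lemma additive_subgroup_2: "additive_subgroup {0, f, g, f + g}"
  by (auto simp: additive_subgroup_def ac_simps)

lemma card_pair: "f \<noteq> 0 \<Longrightarrow> card {0::'a, f} = 2"
  by auto

lemma card_span_pair:
  assumes "f \<noteq> 0" "g \<noteq> 0" "f \<noteq> (g::'a)"
  shows "card {0, f, g, f + g} = 4"
proof -
  have "f + g \<noteq> 0" "f + g \<noteq> f" "f + g \<noteq> g"
    using assms by (auto simp: add_eq_iff)
  then show ?thesis using assms by auto
qed

lemma ex_Tr_1:
  assumes "f \<noteq> 0" "s \<in> {0, 1}"
  shows "\<exists>z. Tr (f * z) = s"
  using assms ex_Tr_mult_eq_1[of f] by (auto intro: exI[of _ 0])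

text \<open>A solution of the first equation is corrected by an element on which \<open>f\<close>
  has trace 0 and \<open>g\<close> has trace 1. With \<open>ex_Tr_3\<close>, which repeats the
  correction, this says that the traces of independent functionals can be prescribed freely.\<close>

lemma ex_Tr_2:
  assumes "f \<noteq> 0" "g \<noteq> 0" "f \<noteq> g" "s \<in> {0, 1}" "t \<in> {0, 1}"
  shows "\<exists>z. Tr (f * z) = s \<and> Tr (g * z) = t"
proof -
  have "\<exists>x. Tr (f * x) = 0 \<and> Tr (g * x) = 1"
    using ex_perp_Tr_eq_1[OF additive_subgroup_1[of f], of g] assms by (auto simp: perp_def)
  then obtain x where x: "Tr (f * x) = 0" "Tr (g * x) = 1" by blast
  obtain y where y: "Tr (f * y) = s"
    using ex_Tr_1 assms by blast
  show ?thesis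
  proof (cases "Tr (g * y) = t")
    case False
    then have "Tr (g * y) + 1 = t"
      using Tr_in_F2[of "g * y"] assms by auto
    then show ?thesis
      using x y by (intro exI[of _ "y + x"]) (simp add: distrib_left Tr_add)
  qed (use y in blast)
qed

lemma ex_Tr_3:
  assumes "f \<noteq> 0" "g \<noteq> 0" "f \<noteq> g" "k \<notin> {0, f, g, f + g}" "s \<in> {0, 1}" "t \<in> {0, 1}" "u \<in> {0, 1}"
  shows "\<exists>z. Tr (f * z) = s \<and> Tr (g * z) = t \<and> Tr (k * z) = u"
proof -
  obtain x where x: "Tr (f * x) = 0" "Tr (g * x) = 0" "Tr (k * x) = 1"
    using ex_perp_Tr_eq_1[OF additive_subgroup_2[of f g] assms(4)] by (auto simp: perp_def)
  obtain y where y: "Tr (f * y) = s" "Tr (g * y) = t"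
    using ex_Tr_2 assms by blast
  show ?thesis
  proof (cases "Tr (k * y) = u")
    case False
    then have "Tr (k * y) + 1 = u"
      using Tr_in_F2[of "k * y"] assms by auto
    then show ?thesis
      using x y by (intro exI[of _ "y + x"]) (simp add: distrib_left Tr_add)
  qed (use y in blast)
qed

lemma card_Tr_1:
  assumes "f \<noteq> 0" "s \<in> {0, 1}"
  shows "2 * card {z. Tr (f * z) = s} = 2 ^ h"
proof -
  obtain y where y: "Tr (f * y) = s"
    using ex_Tr_1 assms by blast
  have "bij_betw (\<lambda>z. z + y) (perp {0, f}) {z. Tr (f * z) = s}"
    by (rule bij_betw_byWitness[where f' = "\<lambda>z. z + y"])
      (auto simp: perp_def distrib_left Tr_add y add.assoc)
  then show ?thesis
    using card_perp[OF additive_subgroup_1[of f]] assms by (simp add: bij_betw_same_card card_pair)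
qed

text \<open>The solution set is a translate of the annihilator of the group generated by
  \<open>f\<close> and \<open>g\<close>, which has four elements.\<close>

lemma card_Tr_2:
  assumes "f \<noteq> 0" "g \<noteq> 0" "f \<noteq> g" "s \<in> {0, 1}" "t \<in> {0, 1}"
  shows "4 * card {z. Tr (f * z) = s \<and> Tr (g * z) = t} = 2 ^ h"
proof -
  obtain y where y: "Tr (f * y) = s" "Tr (g * y) = t"
    using ex_Tr_2 assms by blast
  have "bij_betw (\<lambda>z. z + y) (perp {0, f, g, f + g}) {z. Tr (f * z) = s \<and> Tr (g * z) = t}"
    by (rule bij_betw_byWitness[where f' = "\<lambda>z. z + y"])
      (auto simp: perp_def distrib_left distrib_right Tr_add y add.assoc)
  then show ?thesis
    using card_perp[OF additive_subgroup_2[of f g]] card_span_pair[OF assms(1-3)]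
    by (simp add: bij_betw_same_card)
qed

section \<open>Hyperplanes as trace conditions\<close>

lemma hyperplane_eq_Tr:
  assumes "additive_subgroup K" and "2 * card K = 2 ^ h"
  shows "\<exists>a. a \<noteq> 0 \<and> K = {z. Tr (a * z) = 0}"
proof -
  \<comment> \<open>By duality a subgroup of index 2 has an annihilator of order 2, whose nonzero
    element is the wanted functional.\<close>
  have "card K * card (perp K) = card K * 2"
    using card_perp[OF assms(1)] assms(2) by simp
  moreover have "card K \<noteq> 0"
    using assms(1) by (auto simp: additive_subgroup_def)
  ultimately have "card (perp K) = 2" by simp
  moreover have "0 \<in> perp K" by (simp add: perp_def)
  ultimately obtain a where a: "a \<noteq> 0" "perp K = {0, a}"
    by (metis card_2_iff doubleton_eq_iff insertE insertI1 singletonD)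
  have "K = perp {0, a}"
    using perp_perp[OF assms(1)] a(2) by simp
  then show ?thesis
    using a(1) by (auto simp: perp_def)
qed

text \<open>The quotients (z0 + k) / c are the affine coordinates of the points of a club other than
  its head; see \<open>club_affine_hyperplane\<close>. Solving for k turns a functional
  \<open>a\<close> vanishing on \<open>K\<close> into \<open>a * c\<close> with constant trace
  \<open>Tr (a * z0)\<close>.\<close>

lemma affine_hyperplane_eq_Tr:
  assumes "additive_subgroup K" and "2 * card K = 2 ^ h" and "c \<noteq> 0"
  shows "\<exists>a e. a \<noteq> 0 \<and> e \<in> {0, 1} \<and> (\<lambda>k. (z0 + k) / c) ` K = {z. Tr (a * z) = e}"
proof -
  obtain a where a: "a \<noteq> 0" "K = {z. Tr (a * z) = 0}"
    using hyperplane_eq_Tr[OF assms(1,2)] by blast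
  have "(\<lambda>k. (z0 + k) / c) ` K = {z. Tr (a * c * z) = Tr (a * z0)}"
  proof (intro Set.set_eqI iffI)
    fix z assume "z \<in> {z. Tr (a * c * z) = Tr (a * z0)}"
    then have "c * z + z0 \<in> K" and "z = (z0 + (c * z + z0)) / c"
      using assms(3) by (auto simp: a(2) distrib_left Tr_add ac_simps)
    then show "z \<in> (\<lambda>k. (z0 + k) / c) ` K"
      by (rule rev_image_eqI)
  next
    fix z assume "z \<in> (\<lambda>k. (z0 + k) / c) ` K"
    then obtain k where "Tr (a * k) = 0" "z = (z0 + k) / c"
      by (auto simp: a(2))
    moreover from this have "a * c * z = a * z0 + a * k"
      using assms(3) by (simp add: field_simps)
    ultimately show "z \<in> {z. Tr (a * c * z) = Tr (a * z0)}"
      by (simp add: Tr_add)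
  qed
  then show ?thesis
    using a(1) assms(3) Tr_in_F2[of "a * z0"]
    by (intro exI[of _ "a * c"] exI[of _ "Tr (a * z0)"]) simp
qed

lemma ex_of_F2: "x \<in> {0, 1} \<Longrightarrow> \<exists>c. x = (of_F2 c :: 'a)"
  by (auto simp: of_F2_def intro: exI[of _ 0] exI[of _ 1])

lemma of_F2_add: "of_F2 (c + d) = (of_F2 c + of_F2 d :: 'a)"
  by (cases c; cases d) (simp_all add: of_F2_def)

section \<open>Configurations of quarter sets\<close>

text \<open>Two hyperplanes with the same functional meet in 0 or q/2 elements, so the three
  functionals are distinct. If they were independent, all three equations would have a common
  solution; so the third is the sum of the others, and emptiness forces its constant to be the wrong
  one.\<close>

lemma three_hyperplanes:
  assumes a: "a1 \<noteq> 0" "a2 \<noteq> 0" "a3 \<noteq> 0"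
    and e: "e1 \<in> {0, 1}" "e2 \<in> {0, 1}" "e3 \<in> {0, 1}"
    and c12: "4 * card ({z. Tr (a1 * z) = e1} \<inter> {z. Tr (a2 * z) = e2}) = 2 ^ h"
    and c13: "4 * card ({z. Tr (a1 * z) = e1} \<inter> {z. Tr (a3 * z) = e3}) = 2 ^ h"
    and c23: "4 * card ({z. Tr (a2 * z) = e2} \<inter> {z. Tr (a3 * z) = e3}) = 2 ^ h"
    and empty: "{z. Tr (a1 * z) = e1} \<inter> {z. Tr (a2 * z) = e2} \<inter> {z. Tr (a3 * z) = e3} = {}"
  shows "a1 \<noteq> a2 \<and> a3 = a1 + a2 \<and> e3 = e1 + e2 + 1"
proof -
  have neq: "x \<noteq> y"
    if "x \<noteq> 0" "4 * card ({z. Tr (x * z) = s} \<inter> {z. Tr (y * z) = t}) = 2 ^ h" "s \<in> {0, 1}"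
    for x y s t
  proof
    assume "x = y"
    then have "{z. Tr (x * z) = s} \<inter> {z. Tr (y * z) = t} = (if s = t then {z. Tr (x * z) = s} else {})"
      by auto
    then have "4 * card {z. Tr (x * z) = s} = 2 ^ h"
      using that(2) by (auto split: if_splits)
    then show False
      using card_Tr_1[OF that(1,3)] zero_less_power[of "2::nat" h] by linarith
  qed
  have distinct: "a1 \<noteq> a2" "a1 \<noteq> a3" "a2 \<noteq> a3"
    using neq a e c12 c13 c23 by blast+
  have "a3 \<in> {0, a1, a2, a1 + a2}"
    using ex_Tr_3[OF a(1,2) distinct(1) _ e] empty by blast
  then have a3: "a3 = a1 + a2"
    using a distinct by auto
  obtain z where z: "Tr (a1 * z) = e1" "Tr (a2 * z) = e2"
    using ex_Tr_2[OF a(1,2) distinct(1) e(1,2)] by blast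
  then have "Tr (a3 * z) = e1 + e2"
    by (simp add: a3 distrib_right Tr_add)
  then have "e3 \<noteq> e1 + e2"
    using empty z by blast
  then have "e3 = e1 + e2 + 1"
    using e by auto
  then show ?thesis using distinct a3 by simp
qed

lemma quarter_set:
  assumes S: "4 * card S = 2 ^ h" "\<And>z. z \<in> S \<Longrightarrow> Tr (f * z) = s \<and> Tr (g * z) = t"
    and fg: "f \<noteq> 0" "g \<noteq> 0" "f \<noteq> g" and st: "s \<in> {0, 1}" "t \<in> {0, 1}"
  shows "S = {z. Tr (f * z) = s \<and> Tr (g * z) = t}"
proof (rule card_subset_eq)
  show "card S = card {z. Tr (f * z) = s \<and> Tr (g * z) = t}"
    using card_Tr_2[OF fg st] S(1) by simp
qed (use S(2) in auto)

text \<open>By its size \<open>S\<close> is the full solution set for \<open>f\<close> and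
  \<open>g\<close>. If \<open>k\<close> were independent of them, some element of \<open>S\<close>
  would give it the trace \<open>u + 1\<close>.\<close>

lemma quarter_set_functional:
  assumes S: "4 * card S = 2 ^ h" "\<And>z. z \<in> S \<Longrightarrow> Tr (f * z) = s \<and> Tr (g * z) = t \<and> Tr (k * z) = u"
    and fg: "f \<noteq> 0" "g \<noteq> 0" "f \<noteq> g" and k: "k \<noteq> 0" "k \<noteq> f" "k \<noteq> g"
    and st: "s \<in> {0, 1}" "t \<in> {0, 1}"
  shows "k = f + g"
proof (rule ccontr)
  assume "k \<noteq> f + g"
  then have "k \<notin> {0, f, g, f + g}" using k by simp
  moreover have "u + 1 \<in> {0, 1}"
  proof -
    obtain z where "z \<in> S" using S(1) by fastforce
    then have "u \<in> {0, 1}" using S(2) Tr_in_F2[of "k * z"] by auto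
    then show ?thesis by auto
  qed
  ultimately obtain z where z: "Tr (f * z) = s" "Tr (g * z) = t" "Tr (k * z) = u + 1"
    using ex_Tr_3[OF fg _ st] by blast
  have "S = {z. Tr (f * z) = s \<and> Tr (g * z) = t}"
    using quarter_set[OF S(1) _ fg st] S(2) by blast
  then have "z \<in> S" using z by simp
  then have "u + 1 = u" using S(2) z(3) by auto
  then show False by (simp add: add_eq_iff)
qed

text \<open>
  \<open>X\<close> and \<open>Y\<close> stand for the point sets of two secants with slopes at distance \<open>d\<close>; the set on the
  left-hand side is their \<open>D_set\<close>.
\<close>

definition linked :: "'a \<Rightarrow> 'a \<Rightarrow> 'a set \<Rightarrow> 'a set \<Rightarrow> 'a \<Rightarrow> bool" where
  "linked a e X Y d \<longleftrightarrow> {(x + y) / d |x y. x \<in> X \<and> y \<in> Y} = {z. Tr (a * z) = e}"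

lemma linked_sym: "linked a e X Y d \<Longrightarrow> linked a e Y X d"
proof -
  have "{(x + y) / d |x y. x \<in> Y \<and> y \<in> X} = {(x + y) / d |x y. x \<in> X \<and> y \<in> Y}"
    by (rule Collect_cong) (metis add.commute)
  then show "linked a e X Y d \<Longrightarrow> linked a e Y X d"
    by (simp add: linked_def)
qed

lemma linkedD: "linked a e X Y d \<Longrightarrow> x \<in> X \<Longrightarrow> y \<in> Y \<Longrightarrow> Tr (a / d * x) + Tr (a / d * y) = e"
proof -
  assume "linked a e X Y d" "x \<in> X" "y \<in> Y"
  then have "Tr (a * ((x + y) / d)) = e"
    unfolding linked_def by blast
  then show ?thesis
    by (simp add: distrib_left add_divide_distrib flip: Tr_add)
qed

text \<open>In \<open>linkedD\<close> one point is held fixed while the other varies, which makes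
  the functional constant on each of the two sets.\<close>

lemma linked_const:
  assumes "linked a e X Y d" "X \<noteq> {}" "Y \<noteq> {}"
  shows "\<exists>t\<in>{0, 1}. (\<forall>x\<in>X. Tr (a / d * x) = t) \<and> (\<forall>y\<in>Y. Tr (a / d * y) = e + t)"
proof -
  obtain x0 y0 where 0: "x0 \<in> X" "y0 \<in> Y" using assms by blast
  have "\<forall>x\<in>X. Tr (a / d * x) = Tr (a / d * x0)"
    using linkedD[OF assms(1) _ 0(2)] linkedD[OF assms(1) 0] by (metis add_right_cancel)
  moreover have "\<forall>y\<in>Y. Tr (a / d * y) = e + Tr (a / d * x0)"
    using linkedD[OF assms(1) 0(1)] by (metis add.commute add_self_left)
  ultimately show ?thesis
    using Tr_in_F2 by blast
qed

text \<open>Since \<open>c = a + b\<close> and \<open>d'' = d + d'\<close>, an equality of two edge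
  functionals carries over to the third edge. Adding the three link equations for points x, y, z
  then counts every trace twice, so the constants would sum to 0.\<close>

lemma no_linked_triangle:
  assumes "linked a e X Y d" "linked b e' X Z d'" "linked c e'' Y Z d''"
    and "X \<noteq> {}" "Y \<noteq> {}" "Z \<noteq> {}" "d \<noteq> 0" "d' \<noteq> 0" "d'' \<noteq> 0"
    and "c = a + b" "d'' = d + d'" "e + e' + e'' \<noteq> 0"
  shows "a / d \<noteq> b / d'"
proof
  assume eq: "a / d = b / d'"
  have "a = a / d * d"
    using assms(7) by simp
  moreover have "b = a / d * d'"
    unfolding eq using assms(8) by simp
  ultimately have "c = a / d * d''"
    using assms(10,11) by (metis distrib_left)
  then have c: "c / d'' = a / d"
    using assms(9) by simp
  obtain x y z where "x \<in> X" "y \<in> Y" "z \<in> Z" using assms by blast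
  then have "e = Tr (a / d * x) + Tr (a / d * y)" "e' = Tr (a / d * x) + Tr (a / d * z)"
      "e'' = Tr (a / d * y) + Tr (a / d * z)"
    using linkedD assms(1-3) eq c by metis+
  then have "e + e' + e'' = 0"
    by (simp add: ac_simps)
  then show False using assms(12) by simp
qed

text \<open>The coordinate change from (z, y, w) to (c z + p y + r w, y, w) acts by these maps on
  the secants of slopes \<open>s\<close> and \<open>s'\<close>, and by z to c z + p on the
  distinguished secant. In a sum of two points \<open>r\<close> cancels and \<open>p\<close> is
  multiplied by \<open>d\<close>.\<close>

lemma linked_affine_image:
  assumes "linked a e X Y d" "d = s + s'" "d \<noteq> 0" "c \<noteq> 0"
  shows "linked (a / c) (e + Tr (a / c * p))
    ((\<lambda>z. c * z + (p * s + r)) ` X) ((\<lambda>z. c * z + (p * s' + r)) ` Y) d"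
proof -
  have *: "(c * x + (p * s + r) + (c * y + (p * s' + r))) / d = c * ((x + y) / d) + p" for x y
  proof -
    have eq: "c * x + (p * s + r) + (c * y + (p * s' + r)) = c * (x + y) + p * d"
      by (simp add: assms(2) algebra_simps two_eq_0)
    show ?thesis
      unfolding eq using assms(3) by (simp add: add_divide_distrib distrib_left)
  qed
  have "{(x + y) / d |x y. x \<in> (\<lambda>z. c * z + (p * s + r)) ` X \<and> y \<in> (\<lambda>z. c * z + (p * s' + r)) ` Y}
      = (\<lambda>z. c * z + p) ` {(x + y) / d |x y. x \<in> X \<and> y \<in> Y}"
    (is "?L = ?R")
  proof (intro Set.set_eqI iffI)
    fix z assume "z \<in> ?L"
    then obtain x y where "x \<in> X" "y \<in> Y"
        "z = (c * x + (p * s + r) + (c * y + (p * s' + r))) / d"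
      by blast
    then show "z \<in> ?R" unfolding * by blast
  next
    fix z assume "z \<in> ?R"
    then obtain x y where "x \<in> X" "y \<in> Y" "z = c * ((x + y) / d) + p"
      by blast
    then show "z \<in> ?L" unfolding *[symmetric] by blast
  qed
  also have "\<dots> = (\<lambda>z. c * z + p) ` {z. Tr (a * z) = e}"
    using assms(1) by (simp add: linked_def)
  also have "\<dots> = {z. Tr (a / c * z) = e + Tr (a / c * p)}"
  proof (intro Set.set_eqI iffI)
    fix z assume z: "z \<in> {z. Tr (a / c * z) = e + Tr (a / c * p)}"
    have "Tr (a * ((z + p) / c)) = e"
      using z by (simp add: add_divide_distrib distrib_left Tr_add ac_simps)
    then show "z \<in> (\<lambda>z. c * z + p) ` {z. Tr (a * z) = e}"
      using assms(4) by (intro image_eqI[of _ _ "(z + p) / c"]) (auto simp: ac_simps)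
  qed (use assms(4) in \<open>auto simp: distrib_left add_divide_distrib Tr_add\<close>)
  finally show ?thesis unfolding linked_def .
qed

text \<open>The four secants form a complete graph in which opposite edges share one numerator 1,
  \<open>a2\<close> or \<open>1 + a2\<close>. With a1 = e1 = 1 the constant e3 = e1 + e2 + 1 becomes
  \<open>e2\<close>, hence its repetition. The relation between the edge functionals at the first
  secant determines \<open>g\<close>; the one at the fourth relates the remaining trace
  constants.\<close>

lemma normalized_configuration:
  fixes a2 e2 g k :: 'a
  assumes gk: "g \<notin> {0, 1}" "k \<notin> {0, 1}" "g \<noteq> k"
    and a2: "a2 \<notin> {0, 1}" and e2: "e2 \<in> {0, 1}"
    and card: "4 * card S0 = 2 ^ h" "4 * card S1 = 2 ^ h" "4 * card S2 = 2 ^ h"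
      "4 * card S3 = 2 ^ h" "4 * card S4 = 2 ^ h"
    and l12: "linked 1 1 S1 S2 1" and l34: "linked 1 1 S3 S4 (g + k)"
    and l13: "linked a2 e2 S1 S3 g" and l24: "linked a2 e2 S2 S4 (1 + k)"
    and l14: "linked (1 + a2) e2 S1 S4 k" and l23: "linked (1 + a2) e2 S2 S3 (1 + g)"
    and S0: "\<And>z. z \<in> S0 \<Longrightarrow> Tr z \<noteq> 1 \<and> Tr (a2 * z) \<noteq> e2"
    and S1: "\<And>z. z \<in> S1 \<Longrightarrow> Tr z = 0 \<and> Tr (a2 / g * z) = 0"
  shows "\<exists>\<alpha> \<beta> a b. \<alpha> \<notin> {0, 1} \<and> \<beta> \<notin> {0, 1} \<and> \<alpha> * \<beta> \<noteq> 1 \<and> \<alpha> * \<beta>\<^sup>2 \<noteq> 1 \<and>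
    g = (\<beta> + 1) / (\<alpha> * \<beta> + 1) \<and> k = \<beta> + 1 \<and>
    S0 = {z. Tr z = 0 \<and> Tr (z / \<alpha>) = of_F2 a} \<and>
    S1 = {z. Tr z = 0 \<and> Tr (z / (\<alpha> * g)) = 0} \<and>
    S2 = {z. Tr z = 1 \<and> Tr (z / (\<alpha> * \<beta>)) = of_F2 b} \<and>
    S3 = {z. Tr (z / (\<alpha> * g)) = of_F2 (a + 1) \<and>
      Tr (z / (\<alpha> * \<beta> * g)) = of_F2 (b + 1)} \<and>
    S4 = {z. Tr (z / (\<alpha> * \<beta>)) = of_F2 (a + b + 1) \<and>
      Tr (z / (\<alpha> * \<beta> * g)) = of_F2 b}"
proof -
  have ne: "S0 \<noteq> {}" "S1 \<noteq> {}" "S2 \<noteq> {}" "S3 \<noteq> {}" "S4 \<noteq> {}"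
    using card by auto
  define f13 f14 f24 f34 where f: "f13 = a2 / g" "f14 = (1 + a2) / k" "f24 = a2 / (1 + k)"
    "f34 = 1 / (g + k)"
  have nz: "g \<noteq> 0" "k \<noteq> 0" "1 + g \<noteq> 0" "1 + k \<noteq> 0" "g + k \<noteq> 0" "1 + a2 \<noteq> 0" "a2 \<noteq> 0"
    using gk a2 by auto
  then have f_nz: "f13 \<noteq> 0" "f14 \<noteq> 0" "f24 \<noteq> 0" "f34 \<noteq> 0"
    by (simp_all add: f)
  \<comment> \<open>In \<open>d1\<close> to \<open>d8\<close> two edges at a common vertex are
    compared; \<open>linked_sym\<close> puts that vertex first.\<close>
  have d1: "1 / 1 \<noteq> a2 / g"
    by (rule no_linked_triangle[OF l12 l13 l23]) (use ne nz in \<open>simp_all add: ac_simps\<close>)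
  have d2: "1 / 1 \<noteq> (1 + a2) / k"
    by (rule no_linked_triangle[OF l12 l14 l24]) (use ne nz in \<open>simp_all add: ac_simps\<close>)
  have d3: "a2 / g \<noteq> (1 + a2) / k"
    by (rule no_linked_triangle[OF l13 l14 l34]) (use ne nz in \<open>simp_all add: ac_simps\<close>)
  have d4: "1 / 1 \<noteq> a2 / (1 + k)"
    by (rule no_linked_triangle[OF linked_sym[OF l12] l24 l14]) (use ne nz in \<open>simp_all add: ac_simps\<close>)
  have d5: "a2 / g \<noteq> 1 / (g + k)"
    by (rule no_linked_triangle[OF linked_sym[OF l13] l34 l14]) (use ne nz in \<open>simp_all add: ac_simps\<close>)
  have d6: "a2 / (1 + k) \<noteq> 1 / (g + k)"
    by (rule no_linked_triangle[OF linked_sym[OF l24] linked_sym[OF l34] l23])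
      (use ne nz in \<open>simp_all add: ac_simps\<close>)
  have d7: "(1 + a2) / k \<noteq> a2 / (1 + k)"
    by (rule no_linked_triangle[OF linked_sym[OF l14] linked_sym[OF l24] l12])
      (use ne nz in \<open>simp_all add: ac_simps\<close>)
  have d8: "(1 + a2) / k \<noteq> 1 / (g + k)"
    by (rule no_linked_triangle[OF linked_sym[OF l14] linked_sym[OF l34] l13])
      (use ne nz in \<open>simp_all add: ac_simps\<close>)
  have d: "1 \<noteq> f13" "1 \<noteq> f14" "f13 \<noteq> f14" "1 \<noteq> f24" "f13 \<noteq> f34" "f24 \<noteq> f34" "f14 \<noteq> f24"
      "f14 \<noteq> f34"
    using d1 d2 d3 d4 d5 d6 d7 d8 by (simp_all add: f)
  obtain t where t: "t \<in> {0, 1}" "\<forall>x\<in>S2. Tr (f24 * x) = t" "\<forall>x\<in>S4. Tr (f24 * x) = e2 + t"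
    using linked_const[OF l24 ne(3,5), folded f(3)] by blast
  obtain u where u: "u \<in> {0, 1}" "\<forall>x\<in>S3. Tr (f34 * x) = u" "\<forall>x\<in>S4. Tr (f34 * x) = 1 + u"
    using linked_const[OF l34 ne(4,5), folded f(4)] by blast
  obtain v where v: "v \<in> {0, 1}" "\<forall>x\<in>S1. Tr (f14 * x) = v" "\<forall>x\<in>S4. Tr (f14 * x) = e2 + v"
    using linked_const[OF l14 ne(2,5), folded f(2)] by blast
  have S1': "Tr z = 0" "Tr (f13 * z) = 0" if "z \<in> S1" for z
    using S1[OF that] by (simp_all add: f)
  have S2: "Tr x = 1" if "x \<in> S2" for x
  proof -
    obtain y where "y \<in> S1" using ne by blast
    then show ?thesis using linkedD[OF l12 _ that] S1 by simp
  qed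
  have S3: "Tr (f13 * x) = e2" if "x \<in> S3" for x
  proof -
    obtain y where "y \<in> S1" using ne by blast
    then show ?thesis using linkedD[OF l13 _ that] S1 by (simp add: f(1))
  qed

  have vertex1: "f14 = 1 + f13"
    by (rule quarter_set_functional[OF card(2), where s = 0 and t = 0 and u = v])
      (use S1' v f_nz d in auto)
  have vertex4: "f14 = f24 + f34"
    by (rule quarter_set_functional[OF card(5), where s = "e2 + t" and t = "1 + u" and u = "e2 + v"])
      (use t u v f_nz d e2 in auto)
  \<comment> \<open>On \<open>S1\<close> both 1 and \<open>f13\<close> have trace 0, so
    \<open>vertex1\<close> gives \<open>v = 0\<close>. Evaluating \<open>vertex4\<close> on
    \<open>S4\<close> then yields the claim.\<close>
  have "t + u = 1"
  proof -
    obtain x y where xy: "x \<in> S1" "y \<in> S4" using ne by blast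
    have "v = 0"
      using v(2)[rule_format, OF xy(1)] S1'[OF xy(1)] by (simp add: vertex1 distrib_right Tr_add)
    moreover have "e2 + v = e2 + t + (1 + u)"
      using v(3)[rule_format, OF xy(2)] t(3)[rule_format, OF xy(2)] u(3)[rule_format, OF xy(2)]
      by (simp add: vertex4 distrib_right Tr_add)
    ultimately have "e2 + (t + (1 + u)) = e2 + 0"
      by (simp add: add.assoc)
    then have "t + (1 + u) = 0" by (simp only: add_left_cancel)
    then show ?thesis by (metis add.left_commute add_eq_0_iff_eq)
  qed
  then have u_eq: "u = t + 1" by (metis add_self_left)

  \<comment> \<open>With these choices the functional \<open>a2\<close> is division by \<alpha>, the
    fourth slope is \<beta> + 1, and 1 + k = \<beta> makes \<open>f24\<close> division by
    \<alpha>\<beta>.\<close>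
  define \<alpha> \<beta> where \<alpha>: "\<alpha> = 1 / a2" and \<beta>: "\<beta> = k + 1"
  have k: "k = \<beta> + 1" by (simp add: \<beta> add.assoc)
  have \<alpha>01: "\<alpha> \<notin> {0, 1}" and \<beta>01: "\<beta> \<notin> {0, 1}"
    using nz a2 by (auto simp: \<alpha> \<beta> ac_simps)
  have a2_eq: "a2 = 1 / \<alpha>" by (simp add: \<alpha>)
  \<comment> \<open>Clearing denominators in \<open>vertex1\<close> gives an equation linear in
    \<open>g\<close>, whose solution is the \<gamma> of the family.\<close>
  have gamma: "g * (\<alpha> * \<beta> + 1) = \<beta> + 1"
  proof -
    have "(1 + a2) * g = k * (g + a2)"
      using vertex1 nz by (simp add: f field_simps)
    then have "(\<alpha> + 1) * g = (\<beta> + 1) * (\<alpha> * g + 1)"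
      using nz \<alpha>01 by (simp add: a2_eq field_simps k)
    moreover have "g * (\<alpha> * \<beta> + 1) + (\<beta> + 1) = (\<alpha> + 1) * g + (\<beta> + 1) * (\<alpha> * g + 1)"
      by (simp add: algebra_simps two_eq_0)
    ultimately show ?thesis
      by (metis add_self add_eq_0_iff_eq)
  qed
  have "\<alpha> * \<beta> + 1 \<noteq> 0"
    using gamma nz k by auto
  then have \<alpha>\<beta>: "\<alpha> * \<beta> \<noteq> 1" and g: "g = (\<beta> + 1) / (\<alpha> * \<beta> + 1)"
    using gamma by (auto simp: eq_divide_eq)
  \<comment> \<open>The slope difference of the last two secants is the \<xi> of the family, so
    \<open>f34\<close> is division by \<xi>.\<close>
  have xi: "g + k = \<alpha> * \<beta> * g"
  proof -
    have "g + k = g + g * (\<alpha> * \<beta> + 1)"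
      using gamma k by simp
    also have "\<dots> = \<alpha> * \<beta> * g"
      by (simp add: algebra_simps two_eq_0)
    finally show ?thesis .
  qed
  have F: "f13 * z = z / (\<alpha> * g)" "f24 * z = z / (\<alpha> * \<beta>)" "f34 * z = z / (\<alpha> * \<beta> * g)"
      "a2 * z = z / \<alpha>" for z
    by (simp_all add: f xi a2_eq \<beta> ac_simps)

  \<comment> \<open>Otherwise multiplying \<open>gamma\<close> by \<beta> gives g = \<beta>, so
    \<open>f13\<close> and \<open>f24\<close> agree. Then \<open>f13\<close> has trace
    \<open>t\<close> on every sum from \<open>S1\<close> and \<open>S2\<close>; but these sums fill
    the hyperplane Tr z = 1, on which \<open>f13\<close> takes both values, being distinct from 0
    and 1.\<close>
  have \<alpha>\<beta>2: "\<alpha> * \<beta>\<^sup>2 \<noteq> 1"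
  proof
    assume "\<alpha> * \<beta>\<^sup>2 = 1"
    then have "g * (\<beta> + 1) = \<beta> * (g * (\<alpha> * \<beta> + 1))"
      by (simp add: algebra_simps power2_eq_square)
    then have "g * (\<beta> + 1) = \<beta> * (\<beta> + 1)"
      by (simp only: gamma)
    then have "g = \<beta>"
      using nz k by simp
    then have f24: "f24 = f13"
      by (simp add: f \<beta> add.commute)
    have "t + 1 \<in> {0, 1}" using t(1) by auto
    then obtain z where z: "Tr (1 * z) = 1" "Tr (f13 * z) = t + 1"
      using ex_Tr_2[of 1 f13 1 "t + 1"] f_nz d by auto
    from z(1) obtain x y where "x \<in> S1" "y \<in> S2" "z = x + y"
      using l12 unfolding linked_def by force
    then have "Tr (f13 * z) = t"
      using S1' t(2) by (simp add: distrib_left Tr_add f24)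
    then show False using z(2) by (simp add: add_eq_iff)
  qed
  \<comment> \<open>The bit \<open>b\<close> records the trace of \<open>f24\<close> on
    \<open>S2\<close>, and \<open>a\<close> the trace of \<open>a2\<close> on \<open>S0\<close>,
    which is the value other than \<open>e2\<close>.\<close>
  obtain b where b: "t = of_F2 b" using ex_of_F2[OF t(1)] by blast
  obtain a where a: "e2 + 1 = of_F2 a"
    using ex_of_F2[of "e2 + 1"] e2 by auto
  have a': "e2 = of_F2 a + 1" using a by (metis add_eq_iff add.commute)
  have one: "of_F2 1 = (1::'a)" by (simp add: of_F2_def)
  have "S0 = {z. Tr (1 * z) = 0 \<and> Tr (a2 * z) = e2 + 1}"
  proof (rule quarter_set[OF card(1)])
    fix z assume "z \<in> S0"
    then show "Tr (1 * z) = 0 \<and> Tr (a2 * z) = e2 + 1"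
      using S0[of z] Tr_in_F2[of z] Tr_in_F2[of "a2 * z"] e2 by auto
  qed (use a2 e2 in auto)
  then have S0_eq: "S0 = {z. Tr z = 0 \<and> Tr (z / \<alpha>) = of_F2 a}"
    by (simp only: F a mult_1_left)
  have "S1 = {z. Tr (1 * z) = 0 \<and> Tr (f13 * z) = 0}"
    by (rule quarter_set[OF card(2)]) (use S1' f_nz d in auto)
  then have S1_eq: "S1 = {z. Tr z = 0 \<and> Tr (z / (\<alpha> * g)) = 0}"
    by (simp only: F mult_1_left)
  have "S2 = {z. Tr (1 * z) = 1 \<and> Tr (f24 * z) = t}"
    by (rule quarter_set[OF card(3)]) (use S2 t f_nz d in auto)
  then have S2_eq: "S2 = {z. Tr z = 1 \<and> Tr (z / (\<alpha> * \<beta>)) = of_F2 b}"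
    by (simp only: F b mult_1_left)
  have "S3 = {z. Tr (f13 * z) = e2 \<and> Tr (f34 * z) = u}"
    by (rule quarter_set[OF card(4)]) (use S3 u e2 f_nz d in auto)
  then have S3_eq: "S3 = {z. Tr (z / (\<alpha> * g)) = of_F2 (a + 1) \<and>
      Tr (z / (\<alpha> * \<beta> * g)) = of_F2 (b + 1)}"
    by (simp only: F a' u_eq b of_F2_add one)
  have "S4 = {z. Tr (f24 * z) = e2 + t \<and> Tr (f34 * z) = 1 + u}"
    by (rule quarter_set[OF card(5)]) (use t u e2 f_nz d in auto)
  moreover have "e2 + t = of_F2 (a + b + 1)" "1 + u = of_F2 b"
    by (simp_all only: a' u_eq b of_F2_add one ac_simps add_self add_self_left add_0_right)
  ultimately have S4_eq: "S4 = {z. Tr (z / (\<alpha> * \<beta>)) = of_F2 (a + b + 1) \<and>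
      Tr (z / (\<alpha> * \<beta> * g)) = of_F2 b}"
    by (simp only: F)
  show ?thesis
    by (rule exI[of _ \<alpha>], rule exI[of _ \<beta>], rule exI[of _ a], rule exI[of _ b], intro conjI)
      (fact \<alpha>01 \<beta>01 \<alpha>\<beta> \<alpha>\<beta>2 g k S0_eq S1_eq S2_eq S3_eq S4_eq)+
qed

text \<open>Reduction to the normalized case: scaling by \<open>c = a1\<close> turns the first
  functional into 1, the shear by \<open>p\<close> turns its constant into 1, and the shift by
  \<open>r\<close>, which fixes the distinguished secant, makes 1 and \<open>a' / g\<close> have
  trace 0 on \<open>S1\<close>.\<close>

lemma configuration:
  fixes a1 a2 a3 e1 e2 e3 g k :: 'a
  assumes gk: "g \<notin> {0, 1}" "k \<notin> {0, 1}" "g \<noteq> k"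
    and a: "a1 \<noteq> 0" "a2 \<noteq> 0" "a1 \<noteq> a2" "a3 = a1 + a2"
    and e: "e1 \<in> {0, 1}" "e2 \<in> {0, 1}" "e3 = e1 + e2 + 1"
    and card: "4 * card S0 = 2 ^ h" "4 * card S1 = 2 ^ h" "4 * card S2 = 2 ^ h"
      "4 * card S3 = 2 ^ h" "4 * card S4 = 2 ^ h"
    and l12: "linked a1 e1 S1 S2 1" and l34: "linked a1 e1 S3 S4 (g + k)"
    and l13: "linked a2 e2 S1 S3 g" and l24: "linked a2 e2 S2 S4 (1 + k)"
    and l14: "linked a3 e3 S1 S4 k" and l23: "linked a3 e3 S2 S3 (1 + g)"
    and S0: "\<forall>z\<in>S0. Tr (a1 * z) \<noteq> e1 \<and> Tr (a2 * z) \<noteq> e2"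
  shows "\<exists>c p r. c \<noteq> 0 \<and> (\<exists>\<alpha> \<beta> a b. \<alpha> \<notin> {0, 1} \<and> \<beta> \<notin> {0, 1} \<and> \<alpha> * \<beta> \<noteq> 1 \<and> \<alpha> * \<beta>\<^sup>2 \<noteq> 1 \<and>
    g = (\<beta> + 1) / (\<alpha> * \<beta> + 1) \<and> k = \<beta> + 1 \<and>
    (\<lambda>z. c * z + p) ` S0 = {z. Tr z = 0 \<and> Tr (z / \<alpha>) = of_F2 a} \<and>
    (\<lambda>z. c * z + (p * 0 + r)) ` S1 = {z. Tr z = 0 \<and> Tr (z / (\<alpha> * g)) = 0} \<and>
    (\<lambda>z. c * z + (p * 1 + r)) ` S2 = {z. Tr z = 1 \<and> Tr (z / (\<alpha> * \<beta>)) = of_F2 b} \<and>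
    (\<lambda>z. c * z + (p * g + r)) ` S3 = {z. Tr (z / (\<alpha> * g)) = of_F2 (a + 1) \<and>
      Tr (z / (\<alpha> * \<beta> * g)) = of_F2 (b + 1)} \<and>
    (\<lambda>z. c * z + (p * k + r)) ` S4 = {z. Tr (z / (\<alpha> * \<beta>)) = of_F2 (a + b + 1) \<and>
      Tr (z / (\<alpha> * \<beta> * g)) = of_F2 b})"
proof -
  have ne: "S0 \<noteq> {}" "S1 \<noteq> {}" "S2 \<noteq> {}" "S3 \<noteq> {}" "S4 \<noteq> {}"
    using card by auto
  have nz: "g \<noteq> 0" "k \<noteq> 0" "1 + g \<noteq> 0" "1 + k \<noteq> 0" "g + k \<noteq> 0"
    using gk by auto
  define a' where "a' = a2 / a1"
  have a': "a1 / a1 = 1" "a2 / a1 = a'" "a3 / a1 = 1 + a'" "a' \<notin> {0, 1}"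
    using a by (auto simp: a'_def add_divide_distrib)
  obtain p where p: "Tr (1 * p) = e1 + 1"
    using ex_Tr_1[of 1 "e1 + 1"] e by auto
  obtain t12 where t12: "t12 \<in> {0, 1}" "\<forall>x\<in>S1. Tr (a1 / 1 * x) = t12"
    using linked_const[OF l12 ne(2,3)] by blast
  obtain t13 where t13: "t13 \<in> {0, 1}" "\<forall>x\<in>S1. Tr (a2 / g * x) = t13"
    using linked_const[OF l13 ne(2,4)] by blast
  \<comment> \<open>Two traces of \<open>r\<close> are to be prescribed at once, which requires
    distinct functionals.\<close>
  have "a1 / 1 \<noteq> a2 / g"
    using no_linked_triangle[OF l12 l13 l23] ne nz a e by (simp add: ac_simps)
  then have "1 \<noteq> a' / g"
    using a nz by (auto simp: a'_def field_simps)
  then obtain r where r: "Tr (1 * r) = t12" "Tr (a' / g * r) = t13"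
    using ex_Tr_2[of 1 "a' / g" t12 t13] t12(1) t13(1) a'(4) nz by auto
  \<comment> \<open>The second and third constants both become \<open>e2'\<close>, because e3 = e1 +
    e2 + 1 and Tr p = e1 + 1.\<close>
  define e2' where "e2' = e2 + Tr (a' * p)"
  have e': "e1 + Tr (1 * p) = 1" "e2 + Tr (a' * p) = e2'" "e3 + Tr ((1 + a') * p) = e2'"
    using p by (simp_all add: e2'_def e(3) distrib_right Tr_add add_ac)
  have inj: "inj_on (\<lambda>z. a1 * z + x) S" for x S
    using a(1) by (auto simp: inj_on_def)
  show ?thesis
  proof (rule exI[of _ a1], rule exI[of _ p], rule exI[of _ r], rule conjI[OF a(1)],
      rule normalized_configuration[OF gk a'(4)])
    show "e2' \<in> {0, 1}"
      using e(2) Tr_in_F2[of "a' * p"] by (auto simp: e2'_def)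
    show "linked 1 1 ((\<lambda>z. a1 * z + (p * 0 + r)) ` S1) ((\<lambda>z. a1 * z + (p * 1 + r)) ` S2) 1"
      using linked_affine_image[OF l12 _ _ a(1), of 0 1 p r] a' e' by simp
    show "linked 1 1 ((\<lambda>z. a1 * z + (p * g + r)) ` S3) ((\<lambda>z. a1 * z + (p * k + r)) ` S4) (g + k)"
      using linked_affine_image[OF l34 _ _ a(1), of g k p r] a' e' nz by simp
    show "linked a' e2' ((\<lambda>z. a1 * z + (p * 0 + r)) ` S1) ((\<lambda>z. a1 * z + (p * g + r)) ` S3) g"
      using linked_affine_image[OF l13 _ _ a(1), of 0 g p r] a' e' nz by simp
    show "linked a' e2' ((\<lambda>z. a1 * z + (p * 1 + r)) ` S2) ((\<lambda>z. a1 * z + (p * k + r)) ` S4) (1 + k)"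
      using linked_affine_image[OF l24 _ _ a(1), of 1 k p r] a' e' nz by simp
    show "linked (1 + a') e2' ((\<lambda>z. a1 * z + (p * 0 + r)) ` S1) ((\<lambda>z. a1 * z + (p * k + r)) ` S4) k"
      using linked_affine_image[OF l14 _ _ a(1), of 0 k p r] a' e' nz by simp
    show "linked (1 + a') e2' ((\<lambda>z. a1 * z + (p * 1 + r)) ` S2) ((\<lambda>z. a1 * z + (p * g + r)) ` S3) (1 + g)"
      using linked_affine_image[OF l23 _ _ a(1), of 1 g p r] a' e' nz by simp
    fix z assume "z \<in> (\<lambda>z. a1 * z + p) ` S0"
    then obtain x where x: "x \<in> S0" "z = a1 * x + p" by blast
    have "a' * z = a2 * x + a' * p"
      using a(1) by (simp add: x(2) a'_def distrib_left)
    then have "Tr (a' * z) = Tr (a2 * x) + Tr (a' * p)"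
      by (simp only: Tr_add)
    moreover have "Tr z = Tr (a1 * x) + e1 + 1"
      using p by (simp add: x(2) Tr_add add.assoc)
    ultimately show "Tr z \<noteq> 1 \<and> Tr (a' * z) \<noteq> e2'"
      using S0[rule_format, OF x(1)] by (simp add: e2'_def)
  next
    fix z assume "z \<in> (\<lambda>z. a1 * z + (p * 0 + r)) ` S1"
    then obtain x where x: "x \<in> S1" "z = a1 * x + r" by auto
    have "a' / g * z = a2 / g * x + a' / g * r"
      using a(1) by (simp add: x(2) a'_def distrib_left add_divide_distrib)
    then show "Tr z = 0 \<and> Tr (a' / g * z) = 0"
      using t12(2)[rule_format, OF x(1)] t13(2)[rule_format, OF x(1)] r by (simp add: x(2) Tr_add)
  qed (use card inj in \<open>simp_all add: card_image\<close>)
qed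

section \<open>Cardinalities of subspaces over the prime field and of clubs\<close>

lemma card_F2_subspace:
  fixes W :: "('a ^ 3) set"
  assumes "F2_subspace W"
  shows "card W = 2 ^ F2_dim W"
proof -
  interpret F2: vector_space "F2_scale :: bit \<Rightarrow> 'a ^ 3 \<Rightarrow> 'a ^ 3"
    by (rule vector_space_F2_scale[OF card_field])
  have card_span: "card (F2.span B) = 2 ^ card B" if "F2.independent B" for B :: "('a ^ 3) set"
    using finite[of B] that
  proof (induction B rule: finite_induct)
    case (insert b B)
    then have ind: "F2.independent B" "b \<notin> F2.span B"
      by (simp_all add: F2.independent_insert)
    \<comment> \<open>With only two scalars, a new basis vector adjoins exactly one coset, so the
      cardinality doubles.\<close>
    have "F2.span (insert b B) = F2.span B \<union> (+) b ` F2.span B"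
    proof (intro Set.set_eqI iffI)
      fix x assume "x \<in> F2.span (insert b B)"
      then obtain k where k: "x - F2_scale k b \<in> F2.span B"
        by (auto simp: F2.span_insert)
      show "x \<in> F2.span B \<union> (+) b ` F2.span B"
      proof (cases "k = 0")
        case False
        then have "k = 1" by (cases k) auto
        then have "x - b \<in> F2.span B" using k by simp
        then show ?thesis by (intro UnI2 image_eqI[of _ _ "x - b"]) auto
      qed (use k in simp)
    next
      fix x assume "x \<in> F2.span B \<union> (+) b ` F2.span B"
      then have "x - F2_scale 0 b \<in> F2.span B \<or> x - F2_scale 1 b \<in> F2.span B"
        by auto
      then show "x \<in> F2.span (insert b B)"
        unfolding F2.span_insert by blast
    qed
    moreover have "F2.span B \<inter> (+) b ` F2.span B = {}"
    proof -
      have "b + y \<notin> F2.span B" if "y \<in> F2.span B" for y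
        using ind(2) that F2.span_diff[of "b + y" B y] by auto
      then show ?thesis by auto
    qed
    moreover have "card ((+) b ` F2.span B) = card (F2.span B)"
      by (rule card_image) simp
    ultimately show ?case
      using insert ind by (simp add: card_Un_disjoint)
  qed simp
  obtain B where B: "B \<subseteq> W" "F2.independent B" "W \<subseteq> F2.span B" "card B = F2_dim W"
    using F2.basis_exists[of W] by blast
  then have "W = F2.span B"
    using F2.span_minimal[OF B(1) assms] by blast
  then show ?thesis
    using card_span[OF B(2)] B(4) by simp
qed

lemma F2_subspace_Int:
  fixes W P :: "('a ^ 3) set"
  assumes "F2_subspace W" "vec.subspace P"
  shows "F2_subspace (W \<inter> P)"
proof -
  interpret F2: vector_space "F2_scale :: bit \<Rightarrow> 'a ^ 3 \<Rightarrow> 'a ^ 3"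
    by (rule vector_space_F2_scale[OF card_field])
  have "F2.subspace P"
    using assms(2) by (simp add: F2.subspace_def vec.subspace_def F2_scale_def)
  then show ?thesis
    by (rule F2.subspace_inter[OF assms(1)])
qed

lemma F2_subspaceD:
  fixes W :: "('a ^ 3) set"
  assumes "F2_subspace W"
  shows "0 \<in> W" and "x \<in> W \<Longrightarrow> y \<in> W \<Longrightarrow> x + y \<in> W"
proof -
  interpret F2: vector_space "F2_scale :: bit \<Rightarrow> 'a ^ 3 \<Rightarrow> 'a ^ 3"
    by (rule vector_space_F2_scale[OF card_field])
  show "0 \<in> W" and "x \<in> W \<Longrightarrow> y \<in> W \<Longrightarrow> x + y \<in> W"
    using assms F2.subspace_0 F2.subspace_add by blast+
qed

lemma card_Int_point:
  fixes W P :: "('a ^ 3) set"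
  assumes "F2_subspace W" "vec.subspace P"
  shows "card (W \<inter> P) = 2 ^ weight W P"
  unfolding weight_def by (rule card_F2_subspace[OF F2_subspace_Int[OF assms]])

text \<open>A point of weight 1 contains exactly one nonzero vector of \<open>W\<close>. Hence the
  vectors of \<open>W\<close> outside the head correspond to the points other than the head.\<close>

lemma club_with_head_card:
  fixes S :: "('a ^ 3) set set"
  assumes "club_with_head l i k H S"
  shows "0 < i" and "card S + 2 ^ i = 2 ^ k + 1"
proof -
  obtain W where W: "F2_subspace W" "F2_dim W = k" "S = linear_set W" "H \<in> S" "weight W H = i"
      "\<And>P. P \<in> S - {H} \<Longrightarrow> weight W P = 1"
    using assms unfolding club_with_head_def by blast
  have sub: "vec.subspace P" if "P \<in> S" for P
    using that by (auto simp: W(3) linear_set_def)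
  obtain v0 where v0: "v0 \<in> W" "v0 \<noteq> 0" "H = vec.span {v0}"
    using W(3,4) by (auto simp: linear_set_def)
  then have "{0, v0} \<subseteq> W \<inter> H"
    using F2_subspaceD(1)[OF W(1)] by (auto intro: vec.span_zero vec.span_base)
  then have "card {0, v0} \<le> card (W \<inter> H)"
    by (intro card_mono) auto
  then have "2 \<le> card (W \<inter> H)"
    using v0(2) by auto
  then have "2 \<le> (2::nat) ^ i"
    using card_Int_point[OF W(1) sub[OF W(4)]] by (simp add: W(5))
  then show "0 < i" by (cases i) auto
  have "bij_betw (\<lambda>v. vec.span {v}) (W - H) (S - {H})"
  proof (rule bij_betwI')
    fix v v' assume v: "v \<in> W - H" "v' \<in> W - H"
    have nz: "v \<noteq> 0" "v' \<noteq> 0" using v vec.subspace_0[OF sub[OF W(4)]] by auto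
    show "vec.span {v} = vec.span {v'} \<longleftrightarrow> v = v'"
    proof
      assume eq: "vec.span {v} = vec.span {v'}"
      have "vec.span {v} \<in> S - {H}"
        using v nz vec.span_base[of v "{v}"] by (auto simp: W(3) linear_set_def)
      then have "card (W \<inter> vec.span {v}) = 2"
        using card_Int_point[OF W(1) sub] W(6) by force
      moreover have "{0, v, v'} \<subseteq> W \<inter> vec.span {v}"
        using v F2_subspaceD(1)[OF W(1)] vec.span_base[of v' "{v'}"]
        by (auto simp: eq intro: vec.span_zero) (simp_all add: vec.span_base flip: eq)
      ultimately have "card {0, v, v'} \<le> 2"
        by (metis card_mono finite)
      then show "v = v'"
        using nz by (auto simp: card_insert_if split: if_splits)
    qed simp
  next
    fix v assume "v \<in> W - H"
    then show "vec.span {v} \<in> S - {H}"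
      using vec.span_base[of v "{v}"] vec.subspace_0[OF sub[OF W(4)]]
      by (auto simp: W(3) linear_set_def)
  next
    fix P assume P: "P \<in> S - {H}"
    then obtain v where v: "v \<in> W" "v \<noteq> 0" "P = vec.span {v}"
      by (auto simp: W(3) linear_set_def)
    have "v \<notin> H"
    proof
      assume "v \<in> H"
      then obtain c where c: "v = c *s v0"
        using v0(3) by (auto simp: vec.span_singleton)
      then have "c \<noteq> 0" using v(2) by auto
      then have "v0 = inverse c *s v" by (simp add: c)
      then have "v0 \<in> vec.span {v}"
        by (metis insertI1 vec.span_base vec.span_scale)
      then have "H = P"
        using c vec.span_eq[of "{v}" "{v0}"] \<open>v \<in> H\<close> v(3) v0(3) by simp
      then show False using P by simp
    qed
    then show "\<exists>v\<in>W - H. P = vec.span {v}" using v by blast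
  qed
  then have "card (W - H) = card (S - {H})"
    by (rule bij_betw_same_card)
  moreover have "card W = card (W \<inter> H) + card (W - H)"
    using card_Int_Diff[of W H] by simp
  moreover have "card S = card (S - {H}) + 1"
    using W(4) card_Suc_Diff1[of S H] by simp
  ultimately show "card S + 2 ^ i = 2 ^ k + 1"
    using card_F2_subspace[OF W(1)] card_Int_point[OF W(1) sub[OF W(4)]] W(2,5) by simp
qed

section \<open>Points and lines as spans\<close>

lemma point_eq_span:
  fixes P :: "('a ^ 3) set"
  assumes "P \<in> points"
  obtains v where "v \<noteq> 0" "P = vec.span {v}"
proof -
  have P: "vec.subspace P" "vec.dim P = 1" using assms by (auto simp: points_def)
  obtain B where B: "B \<subseteq> P" "vec.independent B" "P \<subseteq> vec.span B" "card B = 1"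
    using vec.basis_exists[of P] P(2) by metis
  obtain v where v: "B = {v}" using B(4) by (auto simp: card_1_singleton_iff)
  have "v \<noteq> 0" using B(2) v vec.dependent_zero by auto
  moreover have "P = vec.span {v}"
    using vec.span_minimal[OF B(1) P(1)] B(3) v by auto
  ultimately show ?thesis by (rule that)
qed

lemma line_eq_span:
  fixes l :: "('a ^ 3) set"
  assumes "l \<in> lines" "u \<in> l" "u \<noteq> 0"
  obtains v where "l = vec.span {u, v}" "v \<notin> vec.span {u}"
proof -
  have l: "vec.subspace l" "vec.dim l = 2" using assms(1) by (auto simp: lines_def)
  have "vec.independent {u}" using assms(3) by simp
  then obtain B where B: "{u} \<subseteq> B" "B \<subseteq> l" "vec.independent B" "l \<subseteq> vec.span B"
    using vec.maximal_independent_subset_extend[of "{u}" l] assms(2) by auto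
  have "card B = 2"
    using vec.basis_card_eq_dim[OF B(2,4,3)] l(2) by simp
  then obtain v where v: "B = {u, v}" "u \<noteq> v"
    using B(1) by (auto simp: card_2_iff)
  have "l = vec.span {u, v}"
    using vec.span_minimal[OF B(2) l(1)] B(4) v by auto
  moreover have "v \<notin> vec.span {u}"
  proof -
    have "vec.independent (insert v {u})"
      using B(3) v by (simp add: insert_commute)
    then show ?thesis using v(2) by (auto simp: vec.independent_insert)
  qed
  ultimately show ?thesis by (rule that)
qed

lemma lines_eqI:
  fixes l m :: "('a ^ 3) set"
  assumes "l \<in> lines" "m \<in> lines" "l \<subseteq> m"
  shows "l = m"
  using assms vec.subspace_dim_equal[of l m] by (auto simp: lines_def)

end

section \<open>Coordinates adapted to the nucleus\<close>

locale frame = binary_field h ty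
  for h :: nat and ty :: "'a::{field,finite} itself" +
  fixes n v0 v1 :: "'a ^ 3"
  assumes frame_independent: "z *s n + y *s v0 + w *s v1 = 0 \<Longrightarrow> z = 0 \<and> y = 0 \<and> w = 0"
begin

definition \<phi> :: "'a \<Rightarrow> 'a \<Rightarrow> 'a \<Rightarrow> 'a ^ 3" where
  "\<phi> z y w = z *s n + y *s v0 + w *s v1"

abbreviation Q :: "'a \<Rightarrow> 'a \<Rightarrow> 'a \<Rightarrow> ('a ^ 3) set" where
  "Q z y w \<equiv> vec.span {\<phi> z y w}"

definition line :: "'a \<Rightarrow> 'a \<Rightarrow> ('a ^ 3) set" where
  "line y w = {\<phi> z (k * y) (k * w) |z k. True}"

definition affine_part :: "('a ^ 3) set set \<Rightarrow> 'a \<Rightarrow> 'a \<Rightarrow> 'a set" where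
  "affine_part A y w = {z. Q z y w \<in> A}"

lemma \<phi>_add: "\<phi> z y w + \<phi> z' y' w' = \<phi> (z + z') (y + y') (w + w')"
  by (simp add: \<phi>_def vec.scale_left_distrib)

lemma \<phi>_scale: "c *s \<phi> z y w = \<phi> (c * z) (c * y) (c * w)"
  by (simp add: \<phi>_def vec.scale_right_distrib)

lemma \<phi>_eq_0_iff [simp]: "\<phi> z y w = 0 \<longleftrightarrow> z = 0 \<and> y = 0 \<and> w = 0"
  using frame_independent[of z y w] by (auto simp: \<phi>_def)

lemma \<phi>_eq_iff [simp]: "\<phi> z y w = \<phi> z' y' w' \<longleftrightarrow> z = z' \<and> y = y' \<and> w = w'"
proof -
  have "\<phi> z y w = \<phi> z' y' w' \<longleftrightarrow> \<phi> z y w + \<phi> z' y' w' = 0"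
  proof -
    have "\<phi> z' y' w' + \<phi> z' y' w' = 0" by (simp add: \<phi>_add)
    then show ?thesis by (metis add_right_cancel)
  qed
  then show ?thesis by (simp add: \<phi>_add)
qed

text \<open>Independence makes the coordinate map injective, and an injective self-map of a finite
  set is surjective.\<close>

lemma \<phi>_surj: "\<exists>z y w. v = \<phi> z y w"
proof -
  have "inj (\<lambda>x :: 'a ^ 3. \<phi> (x $ 1) (x $ 2) (x $ 3))"
  proof (rule injI)
    fix x y :: "'a ^ 3"
    assume "\<phi> (x $ 1) (x $ 2) (x $ 3) = \<phi> (y $ 1) (y $ 2) (y $ 3)"
    then have "x $ 1 = y $ 1 \<and> x $ 2 = y $ 2 \<and> x $ 3 = y $ 3" by simp
    then show "x = y" by (simp add: vec_eq_iff forall_3)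
  qed
  then have "surj (\<lambda>x :: 'a ^ 3. \<phi> (x $ 1) (x $ 2) (x $ 3))"
    by (rule finite_UNIV_inj_surj[OF finite])
  then show ?thesis unfolding surj_def by blast
qed

lemma \<phi>_1_0_0: "\<phi> 1 0 0 = n" by (simp add: \<phi>_def)

lemma n_neq_0: "n \<noteq> 0"
  using \<phi>_eq_0_iff[of 1 0 0] by (simp add: \<phi>_1_0_0)

lemma Q_eq: "Q z y w = {\<phi> (c * z) (c * y) (c * w) |c. True}"
  by (auto simp: vec.span_singleton \<phi>_scale)

lemma span_n_eq: "vec.span {n} = {\<phi> z 0 0 |z. True}"
  using Q_eq[of 1 0 0] by (simp add: \<phi>_1_0_0)

lemma Q_inj: "y \<noteq> 0 \<or> w \<noteq> 0 \<Longrightarrow> Q z y w = Q z' y w \<longleftrightarrow> z = z'"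
proof
  assume "y \<noteq> 0 \<or> w \<noteq> 0" "Q z y w = Q z' y w"
  moreover from this have "\<phi> z y w \<in> Q z' y w" by (metis insertI1 vec.span_base)
  ultimately show "z = z'" by (auto simp: Q_eq)
qed simp

lemma Q_neq: "y * w' \<noteq> y' * w \<Longrightarrow> Q z y w \<noteq> Q z' y' w'"
proof
  assume "y * w' \<noteq> y' * w" "Q z y w = Q z' y' w'"
  moreover from this have "\<phi> z y w \<in> Q z' y' w'" by (metis insertI1 vec.span_base)
  ultimately show False by (auto simp: Q_eq)
qed

lemma Q_scale: "c \<noteq> 0 \<Longrightarrow> Q (c * z) (c * y) (c * w) = Q z y w"
proof -
  assume "c \<noteq> 0"
  then have "{\<phi> (c * z) (c * y) (c * w)} = (\<lambda>x. c *s x) ` {\<phi> z y w}"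
    by (simp add: \<phi>_scale)
  then show ?thesis
    using \<open>c \<noteq> 0\<close> vec.span_image_scale[of "{\<phi> z y w}" "\<lambda>_. c"] by simp
qed

lemma line_eq_span_frame: "vec.span {n, \<phi> z y w} = line y w"
proof -
  have "vec.span {n, \<phi> z y w} = {\<phi> (a + k * z) (k * y) (k * w) |a k. True}"
  proof -
    have "vec.span {n, \<phi> z y w} = {x + x' |x x'. x \<in> vec.span {n} \<and> x' \<in> Q z y w}"
      using vec.span_Un[of "{n}" "{\<phi> z y w}"] by (simp add: insert_commute)
    also have "\<dots> = {\<phi> a 0 0 + \<phi> (k * z) (k * y) (k * w) |a k. True}"
      unfolding span_n_eq Q_eq by blast
    also have "\<dots> = {\<phi> (a + k * z) (k * y) (k * w) |a k. True}"
      by (simp add: \<phi>_add)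
    finally show ?thesis .
  qed
  also have "\<dots> = line y w"
  proof -
    have "\<exists>a. b = a + k * z" for b k by (intro exI[of _ "b + k * z"]) (simp add: add.assoc)
    then show ?thesis unfolding line_def by (auto; metis)
  qed
  finally show ?thesis .
qed

lemma line_scale: "c \<noteq> 0 \<Longrightarrow> line (c * y) (c * w) = line y w"
proof -
  assume c: "c \<noteq> 0"
  have "\<exists>k'. k' * c = k" for k using c by (intro exI[of _ "k / c"]) simp
  then show ?thesis unfolding line_def by (auto simp flip: mult.assoc; metis)
qed

lemma \<phi>_in_line_iff: "\<phi> z y w \<in> line y' w' \<longleftrightarrow> (\<exists>k. y = k * y' \<and> w = k * w')"
  by (auto simp: line_def)

lemma Q_subset_line: "Q z y w \<subseteq> line y w"
  by (auto simp: Q_eq \<phi>_in_line_iff)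

lemma span_n_subset_line: "vec.span {n} \<subseteq> line y w"
  by (auto simp: span_n_eq \<phi>_in_line_iff)

lemma \<phi>_in_span_n_iff: "\<phi> z y w \<in> vec.span {n} \<longleftrightarrow> y = 0 \<and> w = 0"
  by (auto simp: span_n_eq)

lemma point_on_line:
  assumes "P \<in> points" "P \<subseteq> line y w" "P \<noteq> vec.span {n}"
  shows "\<exists>z. P = Q z y w"
proof -
  obtain v where v: "v \<noteq> 0" "P = vec.span {v}" using point_eq_span[OF assms(1)] .
  then have "v \<in> line y w" using assms(2) vec.span_base[of v "{v}"] by auto
  then obtain z k where zk: "v = \<phi> z (k * y) (k * w)" by (auto simp: line_def)
  show ?thesis
  proof (cases "k = 0")
    case True
    then have "P = Q (z * 1) (z * 0) (z * 0)" "z \<noteq> 0" using v zk by auto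
    then have "P = vec.span {n}" using Q_scale[of z 1 0 0] by (simp add: \<phi>_1_0_0)
    then show ?thesis using assms(3) by simp
  next
    case False
    then have "P = Q (k * (z / k)) (k * y) (k * w)" using v zk by simp
    then have "P = Q (z / k) y w" using Q_scale[OF False] by blast
    then show ?thesis by blast
  qed
qed

lemma line_through_n:
  assumes "l \<in> lines" "vec.span {n} \<subseteq> l"
  obtains "l = line 1 0" | s where "l = line s 1"
proof -
  have "n \<in> l" "n \<noteq> 0" using assms(2) vec.span_base[of n "{n}"] n_neq_0 by auto
  then obtain v where v: "l = vec.span {n, v}" "v \<notin> vec.span {n}"
    using line_eq_span[OF assms(1)] by metis
  obtain z y w where zyw: "v = \<phi> z y w" using \<phi>_surj by blast
  then have l: "l = line y w" and nz: "y \<noteq> 0 \<or> w \<noteq> 0"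
    using v line_eq_span_frame \<phi>_in_span_n_iff by auto
  show ?thesis
  proof (cases "w = 0")
    case True
    then show ?thesis using l nz line_scale[of y 1 0] that(1) by simp
  next
    case False
    then show ?thesis using l line_scale[of w "y / w" 1] that(2)[of "y / w"] by simp
  qed
qed

lemma points_on_eq:
  assumes "A \<subseteq> points" "vec.span {n} \<notin> A"
  shows "points_on A (line y w) = (\<lambda>z. Q z y w) ` affine_part A y w"
proof (intro Set.set_eqI iffI)
  fix P assume "P \<in> points_on A (line y w)"
  then have P: "P \<in> A" "P \<subseteq> line y w" by (auto simp: points_on_def)
  then obtain z where "P = Q z y w" using point_on_line[of P] assms by blast
  then show "P \<in> (\<lambda>z. Q z y w) ` affine_part A y w"
    using P by (auto simp: affine_part_def)
qed (auto simp: points_on_def affine_part_def dest: subsetD[OF Q_subset_line])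

lemma card_points_on:
  assumes "A \<subseteq> points" "vec.span {n} \<notin> A" "y \<noteq> 0 \<or> w \<noteq> 0"
  shows "card (points_on A (line y w)) = card (affine_part A y w)"
  unfolding points_on_eq[OF assms(1,2)]
  by (rule card_image) (simp add: inj_on_def Q_inj[OF assms(3)])

section \<open>Joins and the sets \<open>D_set\<close> in coordinates\<close>

lemma join_Q: "join (Q z y w) (Q z' y' w') =
    {\<phi> (a * z + b * z') (a * y + b * y') (a * w + b * w') |a b. True}"
proof -
  have "join (Q z y w) (Q z' y' w') = {x + x' |x x'. x \<in> Q z y w \<and> x' \<in> Q z' y' w'}"
    unfolding join_def vec.span_Un by (simp add: vec.span_span)
  also have "\<dots> = {\<phi> (a * z) (a * y) (a * w) + \<phi> (b * z') (b * y') (b * w') |a b. True}"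
    unfolding Q_eq by blast
  also have "\<dots> = {\<phi> (a * z + b * z') (a * y + b * y') (a * w + b * w') |a b. True}"
    by (simp add: \<phi>_add)
  finally show ?thesis .
qed

text \<open>A combination with last coordinate 0 has coefficients a + b = 0, that is a = b in
  characteristic 2, so it is a multiple of the sum of the two vectors.\<close>

lemma join_Int_line:
  assumes "s \<noteq> s'"
  shows "join (Q x s 1) (Q y s' 1) \<inter> line 1 0 = Q ((x + y) / (s + s')) 1 0"
proof -
  have "join (Q x s 1) (Q y s' 1) \<inter> line 1 0 = Q (x + y) (s + s') 0"
  proof (intro Set.set_eqI iffI)
    fix v assume "v \<in> join (Q x s 1) (Q y s' 1) \<inter> line 1 0"
    then obtain a b where ab: "v = \<phi> (a * x + b * y) (a * s + b * s') (a * 1 + b * 1)"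
        "v \<in> line 1 0"
      by (auto simp: join_Q)
    then have "a = b" by (auto simp: \<phi>_in_line_iff)
    then show "v \<in> Q (x + y) (s + s') 0"
      using ab(1) by (auto simp: Q_eq distrib_left)
  next
    fix v assume "v \<in> Q (x + y) (s + s') 0"
    then obtain c where "v = \<phi> (c * x + c * y) (c * s + c * s') (c * 1 + c * 1)"
      by (auto simp: Q_eq distrib_left)
    then show "v \<in> join (Q x s 1) (Q y s' 1) \<inter> line 1 0"
      by (auto simp: join_Q \<phi>_in_line_iff)
  qed
  also have "\<dots> = Q ((x + y) / (s + s')) 1 0"
    using Q_scale[of "s + s'" "(x + y) / (s + s')" 1 0] assms by simp
  finally show ?thesis .
qed

lemma D_set_eq:
  assumes "A \<subseteq> points" "vec.span {n} \<notin> A" "s \<noteq> s'"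
  shows "D_set A (line 1 0) (line s 1) (line s' 1) =
    (\<lambda>z. Q z 1 0) ` {(x + y) / (s + s') |x y. x \<in> affine_part A s 1 \<and> y \<in> affine_part A s' 1}"
  unfolding D_set_def points_on_eq[OF assms(1,2)]
  using join_Int_line[OF assms(3)] by (auto simp: image_iff; metis)

lemma join_in_lines:
  assumes "s \<noteq> s'"
  shows "join (Q x s 1) (Q y s' 1) \<in> lines"
proof -
  let ?B = "{\<phi> x s 1, \<phi> y s' 1}"
  have "\<phi> x s 1 \<notin> Q y s' 1" using assms by (auto simp: Q_eq)
  then have "vec.independent ?B" "card ?B = 2"
    using assms by (auto simp: vec.independent_insert)
  moreover have "join (Q x s 1) (Q y s' 1) = vec.span ?B"
    unfolding join_def vec.span_Un vec.span_span
    using vec.span_Un[of "{\<phi> x s 1}" "{\<phi> y s' 1}"] by (simp add: insert_commute)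
  ultimately show ?thesis
    by (simp add: lines_def vec.dim_eq_card_independent)
qed

text \<open>A line joining points on two different secants misses the nucleus, so it is not a
  t-secant and carries at most two points of the arc. A point of the arc on the distinguished secant
  would be a third one.\<close>

lemma KM_arc_no_three:
  assumes KM: "KM_arc t A" and sec: "\<And>l. l \<in> secants t A \<Longrightarrow> vec.span {n} \<subseteq> l"
    and "s \<noteq> s'" "x \<in> affine_part A s 1" "y \<in> affine_part A s' 1"
  shows "(x + y) / (s + s') \<notin> affine_part A 1 0"
proof
  let ?z = "(x + y) / (s + s')" and ?l = "join (Q x s 1) (Q y s' 1)"
  assume z: "?z \<in> affine_part A 1 0"
  have l: "?l \<in> lines" using assms(3) by (rule join_in_lines)
  have "\<not> vec.span {n} \<subseteq> ?l"
  proof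
    assume "vec.span {n} \<subseteq> ?l"
    then have "\<phi> 1 0 0 \<in> ?l" using vec.span_base[of n "{n}"] by (auto simp: \<phi>_1_0_0)
    then obtain a b where ab: "1 = a * x + b * y" "0 = a * s + b * s'" "0 = a + b"
      by (auto simp: join_Q)
    then have "a = b" by (metis add_eq_0_iff_eq)
    then have "a * (s + s') = 0" using ab(2) by (simp add: distrib_left)
    then have "a = 0" using assms(3) by simp
    then show False using ab(1) \<open>a = b\<close> by simp
  qed
  then have "card (points_on A ?l) \<noteq> t"
    using sec l by (auto simp: secants_def)
  moreover have "card (points_on A ?l) \<in> {0, 2, t}"
    using KM l unfolding KM_arc_def by blast
  ultimately have "card (points_on A ?l) \<le> 2" by auto
  moreover have "{Q x s 1, Q y s' 1, Q ?z 1 0} \<subseteq> points_on A ?l"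
  proof -
    have "Q ?z 1 0 \<subseteq> ?l" using join_Int_line[OF assms(3)] by blast
    moreover have "Q x s 1 \<subseteq> ?l" "Q y s' 1 \<subseteq> ?l"
      unfolding join_def by (auto intro: vec.span_base)
    ultimately show ?thesis
      using assms(4,5) z by (auto simp: points_on_def affine_part_def)
  qed
  ultimately have "card {Q x s 1, Q y s' 1, Q ?z 1 0} \<le> 2"
    by (meson card_mono finite order_trans)
  moreover have "Q x s 1 \<noteq> Q y s' 1" "Q x s 1 \<noteq> Q ?z 1 0" "Q y s' 1 \<noteq> Q ?z 1 0"
    using assms(3) Q_neq[of s 1 s' 1 x y] Q_neq[of s 0 1 1 x ?z] Q_neq[of s' 0 1 1 y ?z]
    by simp_all
  ultimately show False by simp
qed

text \<open>Half of the 2^h vectors of \<open>W\<close> lie in the head and form the group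
  \<open>K\<close>; the other half is a single coset of it. Dividing by its common second coordinate
  \<open>c\<close> gives the affine coordinates of the remaining points.\<close>

lemma club_affine_hyperplane:
  assumes "club_with_head (line 1 0) (h - 1) h (vec.span {n}) ((\<lambda>z. Q z 1 0) ` E \<union> {vec.span {n}})"
  shows "\<exists>a e. a \<noteq> 0 \<and> e \<in> {0, 1} \<and> E = {z. Tr (a * z) = e}"
proof -
  let ?N = "vec.span {n}"
  obtain W where W: "F2_subspace W" "W \<subseteq> line 1 0" "F2_dim W = h"
      "(\<lambda>z. Q z 1 0) ` E \<union> {?N} = linear_set W" "weight W ?N = h - 1"
    using assms[unfolded club_with_head_def] by (elim exE conjE) (rule that)
  define K where "K = {z. \<phi> z 0 0 \<in> W}"
  have "W \<inter> ?N = (\<lambda>z. \<phi> z 0 0) ` K" by (auto simp: K_def span_n_eq)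
  moreover have "inj_on (\<lambda>z. \<phi> z 0 0) K" by (simp add: inj_on_def)
  ultimately have "card K = 2 ^ (h - 1)"
    using card_Int_point[OF W(1), of ?N] W(5) by (simp add: card_image)
  then have card_K: "2 * card K = 2 ^ h"
    using h_pos by (cases h) auto
  have add_K: "\<phi> z y w + \<phi> k 0 0 \<in> W \<longleftrightarrow> \<phi> z y w \<in> W" if "k \<in> K" for z y w k
  proof -
    have k: "\<phi> k 0 0 \<in> W" using that by (simp add: K_def)
    have "\<phi> z y w + \<phi> k 0 0 + \<phi> k 0 0 = \<phi> z y w"
      by (simp add: \<phi>_add add.assoc)
    then show ?thesis using F2_subspaceD(2)[OF W(1) _ k] by metis
  qed
  have sub_K: "additive_subgroup K"
    using F2_subspaceD[OF W(1)] add_K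
    by (auto simp: additive_subgroup_def K_def \<phi>_add simp del: \<phi>_eq_0_iff)
      (metis \<phi>_eq_0_iff)
  have card_W: "card W = 2 ^ h" using card_F2_subspace[OF W(1)] W(3) by simp
  have "W \<noteq> W \<inter> ?N"
  proof
    assume "W = W \<inter> ?N"
    then have "(2::nat) ^ h = 2 ^ (h - 1)"
      using card_W card_Int_point[OF W(1), of ?N] W(5) by simp
    then show False using h_pos by simp
  qed
  then obtain v where v: "v \<in> W" "v \<notin> ?N" by blast
  then obtain z0 c where v_eq: "v = \<phi> z0 c 0"
    using W(2) by (auto simp: line_def)
  have c: "c \<noteq> 0" using v(2) v_eq by (auto simp: span_n_eq)
  \<comment> \<open>The two disjoint sets lie in \<open>W\<close>, and each has half as many
    elements as \<open>W\<close>.\<close>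
  have W_eq: "W = (\<lambda>z. \<phi> z 0 0) ` K \<union> (\<lambda>k. \<phi> (z0 + k) c 0) ` K"
  proof (rule card_subset_eq[symmetric])
    show "(\<lambda>z. \<phi> z 0 0) ` K \<union> (\<lambda>k. \<phi> (z0 + k) c 0) ` K \<subseteq> W"
      using v(1) v_eq add_K[of _ z0 c 0] by (auto simp: K_def \<phi>_add)
    have "(\<lambda>z. \<phi> z 0 0) ` K \<inter> (\<lambda>k. \<phi> (z0 + k) c 0) ` K = {}" using c by auto
    then show "card ((\<lambda>z. \<phi> z 0 0) ` K \<union> (\<lambda>k. \<phi> (z0 + k) c 0) ` K) = card W"
      using card_K card_W by (simp add: card_Un_disjoint card_image inj_on_def)
  qed simp
  have "(\<lambda>z. Q z 1 0) ` E = (\<lambda>z. Q z 1 0) ` ((\<lambda>k. (z0 + k) / c) ` K)"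
  proof -
    have N_neq: "?N \<noteq> Q z 1 0" for z
      using vec.span_base[of "\<phi> z 1 0" "{\<phi> z 1 0}"] \<phi>_in_span_n_iff by auto
    have lin: "linear_set W - {?N} = (\<lambda>k. Q (z0 + k) c 0) ` K"
    proof (intro Set.set_eqI iffI)
      fix P assume P: "P \<in> linear_set W - {?N}"
      then obtain u where u: "u \<in> W" "u \<noteq> 0" "P = vec.span {u}" by (auto simp: linear_set_def)
      from u(1) show "P \<in> (\<lambda>k. Q (z0 + k) c 0) ` K"
        unfolding W_eq
      proof
        assume "u \<in> (\<lambda>z. \<phi> z 0 0) ` K"
        then obtain z where z: "u = \<phi> (z * 1) (z * 0) (z * 0)" by auto
        then have "z \<noteq> 0" using u(2) by auto
        then have "P = ?N" using u(3) z Q_scale[of z 1 0 0] by (simp add: \<phi>_1_0_0)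
        then show ?thesis using P by simp
      qed (use u(3) in auto)
    next
      fix P assume "P \<in> (\<lambda>k. Q (z0 + k) c 0) ` K"
      then obtain k where k: "k \<in> K" "P = Q (z0 + k) c 0" by blast
      then have "\<phi> (z0 + k) c 0 \<in> W" unfolding W_eq by blast
      moreover have "P \<noteq> ?N"
        using c k(2) vec.span_base[of "\<phi> (z0 + k) c 0" "{\<phi> (z0 + k) c 0}"]
        by (auto simp: \<phi>_in_span_n_iff)
      ultimately show "P \<in> linear_set W - {?N}"
        using k(2) c by (auto simp: linear_set_def)
    qed
    have "(\<lambda>z. Q z 1 0) ` E = linear_set W - {?N}"
      unfolding W(4)[symmetric] using N_neq by auto
    also have "\<dots> = (\<lambda>k. Q ((z0 + k) / c) 1 0) ` K"
      unfolding lin using Q_scale[OF c, of "_ / c" 1 0] c by simp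
    finally show ?thesis by (simp add: image_image)
  qed
  moreover have "inj (\<lambda>z. Q z 1 0)" using Q_inj[of 1 0] by (simp add: inj_def)
  ultimately have "E = (\<lambda>k. (z0 + k) / c) ` K" by (simp add: inj_image_eq_iff)
  then show ?thesis
    using affine_hyperplane_eq_Tr[OF sub_K card_K c, of z0] by simp
qed

lemma ex_normalizing_matrix:
  assumes "c \<noteq> 0"
  shows "\<exists>M :: 'a ^ 3 ^ 3. invertible M \<and>
    (\<forall>z y w. (\<lambda>v. M *v v) ` Q z y w = pt (c * z + p * y + r * w) y w)"
proof -
  \<comment> \<open>The inverse map is written down first. The listed vectors are the columns of
    \<open>G\<close>, which explains the exchanged indices.\<close>
  define G :: "'a ^ 3 ^ 3" where
    "G = (\<chi> i j. (vector [\<phi> (1 / c) 0 0, \<phi> (p / c) 1 0, \<phi> (r / c) 0 1] :: 'a ^ 3 ^ 3) $ j $ i)"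
  have G: "G *v x = \<phi> ((x $ 1 + p * x $ 2 + r * x $ 3) / c) (x $ 2) (x $ 3)" for x
  proof -
    have "G *v x = x $ 1 *s \<phi> (1 / c) 0 0 + x $ 2 *s \<phi> (p / c) 1 0 + x $ 3 *s \<phi> (r / c) 0 1"
      by (simp add: vec_eq_iff G_def matrix_vector_mult_def sum_3 mult.commute)
    then show ?thesis by (simp add: \<phi>_scale \<phi>_add add_divide_distrib mult.commute)
  qed
  have "inj ((*v) G)"
  proof (rule injI)
    fix x y
    assume "G *v x = G *v y"
    then have "x $ 1 = y $ 1 \<and> x $ 2 = y $ 2 \<and> x $ 3 = y $ 3"
      using assms by (auto simp: G)
    then show "x = y" by (simp add: vec_eq_iff forall_3)
  qed
  then obtain M where M: "M ** G = mat 1"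
    using matrix_left_invertible_injective[of G] by blast
  then have "invertible M"
    using matrix_left_right_inverse invertible_def by metis
  moreover have "(\<lambda>v. M *v v) ` Q z y w = pt (c * z + p * y + r * w) y w" for z y w
  proof -
    have "G *v vector [c * z + p * y + r * w, y, w] = \<phi> z y w"
      using assms by (simp add: G add.assoc add.left_commute two_eq_0)
    then have "M *v \<phi> z y w = vector [c * z + p * y + r * w, y, w]"
      using M by (metis matrix_vector_mul_assoc matrix_vector_mul_lid)
    then show ?thesis
      by (auto simp: pt_def vec.span_singleton image_image vec.scale)
  qed
  ultimately show ?thesis by blast
qed

section \<open>From property (II) to the family\<close>

abbreviation slope_D :: "('a ^ 3) set set \<Rightarrow> 'a \<Rightarrow> 'a \<Rightarrow> ('a ^ 3) set set" where
  "slope_D A s s' \<equiv> D_set A (line 1 0) (line s 1) (line s' 1)"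

lemma PGL_equivalent_arc_family:
  fixes A :: "('a ^ 3) set set"
  assumes KM: "KM_arc (CARD('a) div 4) A"
    and gk: "g \<notin> {0, 1}" "k \<notin> {0, 1}" "g \<noteq> k"
    and secants: "secants (CARD('a) div 4) A = {line 1 0, line 0 1, line 1 1, line g 1, line k 1}"
    and club: "club (line 0 1) (h - 2) (h - 1) (points_on A (line 0 1) \<union> {vec.span {n}})"
    and D_eq: "slope_D A 0 1 = slope_D A g k"
      "slope_D A 0 g = slope_D A 1 k"
      "slope_D A 0 k = slope_D A 1 g"
    and D_club: "\<And>s. s \<in> {1, g, k} \<Longrightarrow> club_with_head (line 1 0) (h - 1) h (vec.span {n})
        (slope_D A 0 s \<union> {vec.span {n}})"
    and D_card: "card (slope_D A 0 1 \<inter> slope_D A 0 g) = CARD('a) div 4"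
      "card (slope_D A 0 1 \<inter> slope_D A 0 k) = CARD('a) div 4"
      "card (slope_D A 0 g \<inter> slope_D A 0 k) = CARD('a) div 4"
    and D_empty: "slope_D A 0 1 \<inter> slope_D A 0 g \<inter>
        slope_D A 0 k = {}"
  shows "\<exists>\<alpha> \<beta> a b. \<alpha> \<notin> {0, 1} \<and> \<beta> \<notin> {0, 1} \<and> \<alpha> * \<beta> \<noteq> 1 \<and> \<alpha> * \<beta>\<^sup>2 \<noteq> 1 \<and>
    PGL_equivalent A (arc_family h \<alpha> \<beta> a b)"
proof -
  let ?N = "vec.span {n}" and ?t = "CARD('a) div 4"
  have A: "A \<subseteq> points" "card A = CARD('a) + ?t"
    using KM by (auto simp: KM_arc_def)
  have card_sec: "card (points_on A l) = ?t"
    if "l \<in> {line 1 0, line 0 1, line 1 1, line g 1, line k 1}" for l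
    using that unfolding secants[symmetric] by (simp add: secants_def)

  obtain H where H: "club_with_head (line 0 1) (h - 2) (h - 1) H (points_on A (line 0 1) \<union> {?N})"
    using club unfolding club_def by blast
  \<comment> \<open>The head has positive weight. As subtraction is truncated, this means h is at
    least 3, so q/4 is an exact quotient.\<close>
  have "0 < h - 2"
    by (rule club_with_head_card(1)[OF H])
  then obtain m where m: "h = m + 2" by (metis add.commute less_imp_add_positive less_diff_conv plus_nat.add_0)
  have t: "4 * ?t = 2 ^ h" "CARD('a) = 4 * ?t"
    using card_field by (simp_all add: m)
  \<comment> \<open>The club on the first secant has 2^(h-1) + 1 - 2^(h-2) = q/4 + 1 points, one
    more than the arc has there, so the nucleus must be the extra point.\<close>
  have "?N \<notin> A"
  proof
    assume "?N \<in> A"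
    then have "points_on A (line 0 1) \<union> {?N} = points_on A (line 0 1)"
      using span_n_subset_line by (auto simp: points_on_def)
    then show False
      using club_with_head_card(2)[OF H] card_sec[of "line 0 1"] t(1) by (simp add: m)
  qed
  note A' = A(1) this

  let ?S = "\<lambda>s. affine_part A s 1" and ?Z = "affine_part A 1 0" and ?R = "\<lambda>z. Q z 1 0"
  have card_part: "card (affine_part A y w) = ?t"
    if "y \<noteq> 0 \<or> w \<noteq> 0" "line y w \<in> {line 1 0, line 0 1, line 1 1, line g 1, line k 1}" for y w
    using card_points_on[OF A' that(1)] card_sec[OF that(2)] by simp
  have card: "4 * card ?Z = 2 ^ h" "4 * card (?S 0) = 2 ^ h" "4 * card (?S 1) = 2 ^ h"
      "4 * card (?S g) = 2 ^ h" "4 * card (?S k) = 2 ^ h"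
    using t(1) by (simp_all add: card_part)

  define E where "E s s' = {(x + y) / (s + s') |x y. x \<in> ?S s \<and> y \<in> ?S s'}" for s s'
  have D: "slope_D A s s' = ?R ` E s s'" if "s \<noteq> s'" for s s'
    unfolding E_def by (rule D_set_eq[OF A' that])
  have inj: "inj ?R" using Q_inj[of 1 0] by (simp add: inj_def)
  have E_eq: "E 0 1 = E g k" "E 0 g = E 1 k" "E 0 k = E 1 g"
    using D_eq D gk inj by (auto simp: inj_image_eq_iff)
  have card_R: "card (?R ` X \<inter> ?R ` Y) = card (X \<inter> Y)" for X Y
    using card_image[OF inj_on_subset[OF inj subset_UNIV], of "X \<inter> Y"] by (simp add: image_Int[OF inj])
  have E_card: "4 * card (E 0 1 \<inter> E 0 g) = 2 ^ h" "4 * card (E 0 1 \<inter> E 0 k) = 2 ^ h"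
      "4 * card (E 0 g \<inter> E 0 k) = 2 ^ h"
    using D_card t(1) D[of 0 1] D[of 0 g] D[of 0 k] gk by (auto simp: card_R)
  have E_empty: "E 0 1 \<inter> E 0 g \<inter> E 0 k = {}"
    using D_empty D[of 0 1] D[of 0 g] D[of 0 k] gk by auto
  have E_hyp: "\<exists>a e. a \<noteq> 0 \<and> e \<in> {0, 1} \<and> E 0 s = {z. Tr (a * z) = e}" if "s \<in> {1, g, k}" for s
  proof (rule club_affine_hyperplane)
    have "0 \<noteq> s" using that gk by auto
    show "club_with_head (line 1 0) (h - 1) h ?N (?R ` E 0 s \<union> {?N})"
      using D_club[OF that] unfolding D[OF \<open>0 \<noteq> s\<close>] .
  qed
  obtain a1 e1 where E1: "a1 \<noteq> 0" "e1 \<in> {0, 1}" "E 0 1 = {z. Tr (a1 * z) = e1}"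
    using E_hyp[of 1] by blast
  obtain a2 e2 where E2: "a2 \<noteq> 0" "e2 \<in> {0, 1}" "E 0 g = {z. Tr (a2 * z) = e2}"
    using E_hyp[of g] by blast
  obtain a3 e3 where E3: "a3 \<noteq> 0" "e3 \<in> {0, 1}" "E 0 k = {z. Tr (a3 * z) = e3}"
    using E_hyp[of k] by blast
  have "a1 \<noteq> a2 \<and> a3 = a1 + a2 \<and> e3 = e1 + e2 + 1"
    by (rule three_hyperplanes) (use E1 E2 E3 E_card E_empty in simp_all)
  then have ae: "a1 \<noteq> a2" "a3 = a1 + a2" "e3 = e1 + e2 + 1"
    by simp_all
  have linked_E: "linked a e (?S s) (?S s') (s + s') \<longleftrightarrow> E s s' = {z. Tr (a * z) = e}" for a e s s'
    by (simp add: linked_def E_def)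
  have links: "linked a1 e1 (?S 0) (?S 1) (0 + 1)" "linked a1 e1 (?S g) (?S k) (g + k)"
      "linked a2 e2 (?S 0) (?S g) (0 + g)" "linked a2 e2 (?S 1) (?S k) (1 + k)"
      "linked a3 e3 (?S 0) (?S k) (0 + k)" "linked a3 e3 (?S 1) (?S g) (1 + g)"
    unfolding linked_E by (simp_all flip: E_eq add: E1 E2 E3)
  have sec: "?N \<subseteq> l" if "l \<in> secants ?t A" for l
    using that span_n_subset_line unfolding secants by blast
  have disj: "z \<notin> E s s'" if "z \<in> ?Z" "s \<noteq> s'" for z s s'
    using KM_arc_no_three[OF KM sec that(2)] that(1) unfolding E_def by blast
  \<comment> \<open>By \<open>disj\<close> the coordinates on the distinguished secant avoid the
    first two hyperplanes.\<close>
  have S0: "\<forall>z\<in>?Z. Tr (a1 * z) \<noteq> e1 \<and> Tr (a2 * z) \<noteq> e2"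
    using disj[of _ 0 1] disj[of _ 0 g] gk by (auto simp: E1 E2)
  obtain c p r \<alpha> \<beta> a b where c: "c \<noteq> 0" and \<alpha>\<beta>: "\<alpha> \<notin> {0, 1}" "\<beta> \<notin> {0, 1}" "\<alpha> * \<beta> \<noteq> 1" "\<alpha> * \<beta>\<^sup>2 \<noteq> 1"
    and gk_eq: "g = (\<beta> + 1) / (\<alpha> * \<beta> + 1)" "k = \<beta> + 1"
    and S: "(\<lambda>z. c * z + p) ` ?Z = {z. Tr z = 0 \<and> Tr (z / \<alpha>) = of_F2 a}"
    "(\<lambda>z. c * z + (p * 0 + r)) ` ?S 0 = {z. Tr z = 0 \<and> Tr (z / (\<alpha> * g)) = 0}"
    "(\<lambda>z. c * z + (p * 1 + r)) ` ?S 1 = {z. Tr z = 1 \<and> Tr (z / (\<alpha> * \<beta>)) = of_F2 b}"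
    "(\<lambda>z. c * z + (p * g + r)) ` ?S g = {z. Tr (z / (\<alpha> * g)) = of_F2 (a + 1) \<and>
      Tr (z / (\<alpha> * \<beta> * g)) = of_F2 (b + 1)}"
    "(\<lambda>z. c * z + (p * k + r)) ` ?S k = {z. Tr (z / (\<alpha> * \<beta>)) = of_F2 (a + b + 1) \<and>
      Tr (z / (\<alpha> * \<beta> * g)) = of_F2 b}"
    using configuration[OF gk E1(1) E2(1) ae(1,2) E1(2) E2(2) ae(3) card
      links(1)[simplified] links(2) links(3)[simplified] links(4) links(5)[simplified] links(6) S0]
    by (elim exE conjE) (rule that)
  \<comment> \<open>This is \<gamma> in the shape it takes once \<beta> + 1 has been replaced by
    \<open>k\<close> in the definition of the family.\<close>
  have g_eq: "k / (\<alpha> * \<beta> + 1) = g"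
    using gk_eq by simp
  obtain M :: "'a ^ 3 ^ 3" where M: "invertible M"
      "\<And>z y w. (\<lambda>v. M *v v) ` Q z y w = pt (c * z + p * y + r * w) y w"
    using ex_normalizing_matrix[OF c, of p r] by blast

  let ?T = "\<lambda>y w. (\<lambda>z. Q z y w) ` affine_part A y w"
  have card_T: "card (?T y w) = ?t" if "line y w \<in> {line 1 0, line 0 1, line 1 1, line g 1, line k 1}" for y w
    using card_sec[OF that] by (simp add: points_on_eq[OF A'])
  have disj_T: "?T y w \<inter> ?T y' w' = {}" if "y * w' \<noteq> y' * w" for y w y' w'
    using Q_neq[OF that] by blast
  \<comment> \<open>The five disjoint parts have 5 q/4 = q + q/4 points together, so they exhaust
    the arc.\<close>
  have "?T 1 0 \<union> (?T 0 1 \<union> (?T 1 1 \<union> (?T g 1 \<union> ?T k 1))) = A"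
  proof (rule card_subset_eq)
    show "card (?T 1 0 \<union> (?T 0 1 \<union> (?T 1 1 \<union> (?T g 1 \<union> ?T k 1)))) = card A"
      using gk t(2) A(2) by (simp add: card_Un_disjoint Int_Un_distrib disj_T card_T)
  qed (auto simp: affine_part_def)
  then have "(\<lambda>P. (\<lambda>v. M *v v) ` P) ` A =
      (\<lambda>P. (\<lambda>v. M *v v) ` P) ` ?T 1 0 \<union> (\<lambda>P. (\<lambda>v. M *v v) ` P) ` ?T 0 1 \<union>
      (\<lambda>P. (\<lambda>v. M *v v) ` P) ` ?T 1 1 \<union> (\<lambda>P. (\<lambda>v. M *v v) ` P) ` ?T g 1 \<union>
      (\<lambda>P. (\<lambda>v. M *v v) ` P) ` ?T k 1"
    by (metis image_Un Un_assoc)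
  moreover have "(\<lambda>P. (\<lambda>v. M *v v) ` P) ` (\<lambda>z. Q z y w) ` X =
      {pt z y w |z. z \<in> (\<lambda>z. c * z + (p * y + r * w)) ` X}" for X y w
    by (auto simp: M(2) image_image add.assoc)
  moreover have "arc_family h \<alpha> \<beta> a b = {pt z 1 0 |z. z \<in> (\<lambda>z. c * z + p) ` ?Z} \<union>
      {pt z 0 1 |z. z \<in> (\<lambda>z. c * z + (p * 0 + r)) ` ?S 0} \<union>
      {pt z 1 1 |z. z \<in> (\<lambda>z. c * z + (p * 1 + r)) ` ?S 1} \<union>
      {pt z g 1 |z. z \<in> (\<lambda>z. c * z + (p * g + r)) ` ?S g} \<union>
      {pt z k 1 |z. z \<in> (\<lambda>z. c * z + (p * k + r)) ` ?S k}"
    unfolding arc_family_def Let_def gk_eq(2)[symmetric] g_eq S mem_Collect_eq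
    by (rule refl)
  ultimately have "(\<lambda>P. (\<lambda>v. M *v v) ` P) ` A = arc_family h \<alpha> \<beta> a b"
    by simp
  then have "PGL_equivalent A (arc_family h \<alpha> \<beta> a b)"
    unfolding PGL_equivalent_def using M(1) by blast
  then show ?thesis using \<alpha>\<beta> by blast
qed

end

section \<open>Choice of the frame\<close>

context binary_field
begin

text \<open>A generator of the nucleus is extended by a vector \<open>u\<close> of the first line
  and \<open>v\<close> of the second. The third line then has a nonzero slope \<open>s\<close>, and
  replacing \<open>u\<close> by its multiple by \<open>s\<close> normalises the slope to 1 while
  keeping the first two lines.\<close>

lemma ex_frame:
  fixes l0 l1 l2 N :: "('a ^ 3) set"
  assumes lines: "l0 \<in> lines" "l1 \<in> lines" "l2 \<in> lines" and "distinct [l0, l1, l2]"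
    and N: "N \<in> points" "N \<subseteq> l0" "N \<subseteq> l1" "N \<subseteq> l2"
  shows "\<exists>n v0 v1. frame h n v0 v1 \<and> N = vec.span {n} \<and> l0 = frame.line n v0 v1 1 0 \<and>
    l1 = frame.line n v0 v1 0 1 \<and> l2 = frame.line n v0 v1 1 1"
proof -
  obtain n where n: "n \<noteq> 0" "N = vec.span {n}" using point_eq_span[OF N(1)] .
  then have n_in: "n \<in> l0" "n \<in> l1" using N vec.span_base[of n "{n}"] by auto
  obtain u where u: "l0 = vec.span {n, u}" "u \<notin> vec.span {n}"
    using line_eq_span[OF lines(1) n_in(1) n(1)] .
  obtain v where v: "l1 = vec.span {n, v}" "v \<notin> vec.span {n}"
    using line_eq_span[OF lines(2) n_in(2) n(1)] .
  have "v \<notin> l0"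
  proof
    assume "v \<in> l0"
    then have "l1 \<subseteq> l0"
      unfolding v(1) using n_in(1) lines(1) by (intro vec.span_minimal) (auto simp: lines_def)
    then show False using lines_eqI[OF lines(2,1)] assms(4) by auto
  qed
  have independent: "z = 0 \<and> y = 0 \<and> w = 0" if eq: "z *s n + y *s u + w *s v = 0" for z y w
  proof -
    have "w = 0"
    proof (rule ccontr)
      assume "w \<noteq> 0"
      have "w *s v = - (z *s n + y *s u)"
        using eq by (metis add_eq_0_iff)
      also have "\<dots> \<in> l0"
        unfolding u(1) by (intro vec.span_neg vec.span_add vec.span_scale vec.span_base) auto
      finally have "inverse w *s (w *s v) \<in> l0"
        unfolding u(1) by (rule vec.span_scale)
      then show False using \<open>w \<noteq> 0\<close> \<open>v \<notin> l0\<close> by simp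
    qed
    moreover have "y = 0"
    proof (rule ccontr)
      assume "y \<noteq> 0"
      have "y *s u = - (z *s n)"
        using eq \<open>w = 0\<close> by (simp add: add_eq_0_iff)
      also have "\<dots> \<in> vec.span {n}"
        by (intro vec.span_neg vec.span_scale vec.span_base) auto
      finally have "inverse y *s (y *s u) \<in> vec.span {n}"
        by (rule vec.span_scale)
      then show False using \<open>y \<noteq> 0\<close> u(2) by simp
    qed
    ultimately show ?thesis using eq n(1) by simp
  qed
  interpret F: frame h "TYPE('a)" n u v
    by unfold_locales (rule independent)
  have u_eq: "F.\<phi> 0 1 0 = u" and v_eq: "F.\<phi> 0 0 1 = v" by (simp_all add: F.\<phi>_def)
  have l0: "l0 = F.line 1 0" using F.line_eq_span_frame[of 0 1 0] u(1) by (simp add: u_eq)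
  have l1: "l1 = F.line 0 1" using F.line_eq_span_frame[of 0 0 1] v(1) by (simp add: v_eq)
  have "vec.span {n} \<subseteq> l2" using N n by simp
  then obtain s where s: "l2 = F.line s 1"
    using F.line_through_n[OF lines(3)] l0 assms(4) by auto
  then have "s \<noteq> 0" using l1 assms(4) by auto
  interpret G: frame h "TYPE('a)" n "s *s u" v
  proof unfold_locales
    fix z y w assume "z *s n + y *s (s *s u) + w *s v = 0"
    then have "z *s n + (y * s) *s u + w *s v = 0" by simp
    then show "z = 0 \<and> y = 0 \<and> w = 0"
      using independent[of z "y * s" w] \<open>s \<noteq> 0\<close> by auto
  qed
  have G: "G.line y w = F.line (s * y) w" for y w
    by (simp add: G.line_def F.line_def G.\<phi>_def F.\<phi>_def ac_simps)
  have "frame h n (s *s u) v" by (rule G.frame_axioms)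
  moreover have "l0 = G.line 1 0" using F.line_scale[OF \<open>s \<noteq> 0\<close>, of 1 0] l0 by (simp add: G)
  moreover have "l1 = G.line 0 1" using l1 by (simp add: G)
  moreover have "l2 = G.line 1 1" using s by (simp add: G)
  ultimately show ?thesis using n(2) by blast
qed

end

theorem theorem4p12:
  fixes A :: "('a::{field,finite} ^ 3) set set"
    and l :: "('a ^ 3) set"
    and h :: nat
  assumes "CARD('a) = 2 ^ h"
    and "KM_arc (CARD('a) div 4) A"
    and "l \<in> secants (CARD('a) div 4) A"
    and "property_II h A l"
  shows "\<exists>(\<alpha>::'a) (\<beta>::'a) (a::bit) (b::bit).
           \<alpha> \<notin> {0, 1} \<and> \<beta> \<notin> {0, 1} \<and> \<alpha> * \<beta> \<noteq> 1 \<and> \<alpha> * \<beta>\<^sup>2 \<noteq> 1 \<and>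
           PGL_equivalent A (arc_family h \<alpha> \<beta> a b)"
proof -
  interpret binary_field h "TYPE('a)"
    by unfold_locales (rule assms(1))
  obtain N l1 l2 l3 l4 where dist: "distinct [l, l1, l2, l3, l4]"
    and sec: "secants (CARD('a) div 4) A = {l, l1, l2, l3, l4}"
    and N: "N \<in> points" "\<forall>m \<in> {l, l1, l2, l3, l4}. N \<subseteq> m"
    and P: "\<forall>m \<in> {l1, l2, l3, l4}. club m (h - 2) (h - 1) (points_on A m \<union> {N})"
      "D_set A l l1 l2 = D_set A l l3 l4" "D_set A l l1 l3 = D_set A l l2 l4"
      "D_set A l l1 l4 = D_set A l l2 l3"
      "\<forall>D \<in> {D_set A l l1 l2, D_set A l l1 l3, D_set A l l1 l4}.
        club_with_head l (h - 1) h N (D \<union> {N})"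
      "card (D_set A l l1 l2 \<inter> D_set A l l1 l3) = CARD('a) div 4"
      "card (D_set A l l1 l2 \<inter> D_set A l l1 l4) = CARD('a) div 4"
      "card (D_set A l l1 l3 \<inter> D_set A l l1 l4) = CARD('a) div 4"
      "D_set A l l1 l2 \<inter> D_set A l l1 l3 \<inter> D_set A l l1 l4 = {}"
    using assms(4)[unfolded property_II_def Let_def] by (elim exE conjE) (rule that)
  have "{l, l1, l2, l3, l4} \<subseteq> lines"
    unfolding sec[symmetric] by (auto simp: secants_def)
  then have lines: "l \<in> lines" "l1 \<in> lines" "l2 \<in> lines" "l3 \<in> lines" "l4 \<in> lines"
    by simp_all
  have N_sub: "N \<subseteq> l" "N \<subseteq> l1" "N \<subseteq> l2"
    using N(2) by simp_all
  have "distinct [l, l1, l2]"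
    using dist by simp
  then obtain n v0 v1 where F: "frame h n v0 v1" "N = vec.span {n}" "l = frame.line n v0 v1 1 0"
      "l1 = frame.line n v0 v1 0 1" "l2 = frame.line n v0 v1 1 1"
    using ex_frame[OF lines(1-3) _ N(1) N_sub] by blast
  interpret F: frame h "TYPE('a)" n v0 v1 by (rule F(1))
  have "vec.span {n} \<subseteq> l3" "vec.span {n} \<subseteq> l4" using N(2) F(2) by simp_all
  \<comment> \<open>The last two secants pass through the nucleus and differ from \<open>l\<close>,
    so each has a slope.\<close>
  then obtain g k where gk: "l3 = F.line g 1" "l4 = F.line k 1"
    using F.line_through_n[of l3] F.line_through_n[of l4] lines dist F(3) by (metis distinct_length_2_or_more)
  have "l1 \<noteq> l3" "l2 \<noteq> l3" "l1 \<noteq> l4" "l2 \<noteq> l4" "l3 \<noteq> l4"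
    using dist by simp_all
  then have neq: "g \<notin> {0, 1}" "k \<notin> {0, 1}" "g \<noteq> k"
    unfolding F(4) F(5) gk by blast+
  note II = P[unfolded F(2) F(3) F(4) F(5) gk]
  show ?thesis
  proof (rule F.PGL_equivalent_arc_family[OF assms(2) neq sec[unfolded F(3) F(4) F(5) gk] _
        II(2-4) _ II(6-9)])
    show "club (F.line 0 1) (h - 2) (h - 1) (points_on A (F.line 0 1) \<union> {vec.span {n}})"
      using II(1) by blast
    show "club_with_head (F.line 1 0) (h - 1) h (vec.span {n})
        (D_set A (F.line 1 0) (F.line 0 1) (F.line s 1) \<union> {vec.span {n}})" if "s \<in> {1, g, k}" for s
      using II(5) that by blast
  qed
qed

end
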